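(* Let $\Phi$ denote the fine-grid time-stepping operator and $\Psi$ the coarse-grid time-stepping operator, for all time points (invertible, linear, time-independent $N_x\times N_x$ matrices with $\|\Phi^q\|,\|\Psi^q\|<1$ for some $q$), with coarsening factor $k$, and $N_c$ time points on the coarse grid. Assume that $\Phi$ and $\Psi$ commute and are diagonalizable, with eigenvectors given as columns of $U$, and that $\Phi$ satisfies an FCF-TEAP with respect to $\Psi$, with constant $\varphi_{FCF}<1$. Let $\mathbf{e}_{p+1}$ denote the error vector of two-level MGRiT with FCF-relaxation after $p+1$ iterations. Then $\|\mathbf{e}_1\|_{(UU^* )^{-1}}^2\le k\|\mathbf{e}_0\|_{(UU^* )^{-1}}^2$, and $$\|\mathbf{e}_{p+1}\|_{(UU^* )^{-1}}^2\le\left(\varphi_{FCF}^{2p}-O(1/N_c^2)\right)\|\mathbf{e}_1\|_{(UU^* )^{-1}}^2 .$$ Furthermore, this bound is tight; that is, there exists an initial error $\mathbf{e}_0$ such that the last inequality holds with equality, to $O(1/N_c^2)$. This also provides necessary and sufficient (asymptotic) conditions for convergence in the $\ell^2$- and $A^*A$-norms. That is, iterations may diverge at first, but will eventually converge in the $\ell^2$- and $A^*A$-norms.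
   Context: FCF-TEAP (FCF-relaxation temporal eigenvalue approximation property): let $\{\lambda_\ell\}$ and $\{\mu_\ell\}$ be the eigenvalues of $\Phi$ and $\Psi$, with $\Phi\mathbf{u}_\ell=\lambda_\ell\mathbf{u}_\ell$, $\Psi\mathbf{u}_\ell=\mu_\ell\mathbf{u}_\ell$ for the columns $\mathbf{u}_\ell$ of $U$. $\Phi$ satisfies an FCF-TEAP with respect to $\Psi$ with constant $\varphi_{FCF}$ if $|\mu_\ell-\lambda_\ell^k|\le\varphi_{FCF}\dfrac{1-|\mu_\ell|}{|\lambda_\ell^k|}$ for $\ell=0,\dots,N_x-1$. Norms: for a space-time vector $\mathbf{x}$ with blocks $\mathbf{x}_j\in\mathbb{C}^{N_x}$ (one per time point), $\|\mathbf{x}\|_{(UU^* )^{-1}}^2=\sum_j\|U^{-1}\mathbf{x}_j\|^2$; $\|\mathbf{x}\|_{A^*A}=\|A\mathbf{x}\|$, with $\|\cdot\|$ the Euclidean ($\ell^2$) norm. Algorithm: there are $N=(N_c-1)k+1$ time points $0,\dots,N-1$. $A$ is the $N\times N$ block matrix with $N_x\times N_x$ blocks, identity blocks on the diagonal, $-\Phi$ on the first block subdiagonal, zeros elsewhere; the method iteratively solves $A\mathbf{u}=\mathbf{f}$. C-points are the time points that are multiples of $k$; all others are F-points. Ordering F-points first, $A=\begin{bmatrix} A_{ff} & A_{fc} \\ A_{cf} & A_{cc} \end{bmatrix}$ (with $A_{cc}=I$); $A_\Delta=A_{cc}-A_{cf}A_{ff}^{-1}A_{fc}$; $B_\Delta$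 is the $N_c\times N_c$ block matrix with identity diagonal blocks, $-\Psi$ on the first block subdiagonal, zeros elsewhere. The error (exact solution minus iterate) propagates as $\mathbf{e}_{i+1}=\mathcal{E}_{FCF}\mathbf{e}_i$, where $$\mathcal{E}_{FCF}=\begin{bmatrix} -A_{ff}^{-1}A_{fc} \\ I \end{bmatrix}\begin{bmatrix} 0 & (I-B_\Delta^{-1}A_\Delta)A_{cf}A_{ff}^{-1}A_{fc} \end{bmatrix}.$$ Convention: $O(1/N_c^2)$ denotes a positive term of that order as $N_c$ grows, $\Phi$ and $\Psi$ being independent of $N_c$.
   Formalization: Tightness and necessity of φ_FCF<1 are stated for the least FCF-TEAP constant (they fail for larger ones); for p=0 the O(1/N_c^2) term is zero; convergence is read as uniform in N_c, since for fixed N_c the error propagator is nilpotent. *)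

theory Defs
  imports "HOL-Analysis.Analysis" "HOL-Library.Landau_Symbols"
begin

text \<open>
  The spatial dimension is \<open>CARD('n)\<close>. Block vectors and block matrices are indexed by natural
  numbers, since the number of time points varies within the theorem. Only the entries with index
  in the relevant finite index set are meaningful, and every operation takes that set as an
  argument. In particular a submatrix such as \<open>A\<^sub>f\<^sub>c\<close> needs no separate name or reordering: it is the
  same function \<open>A\<close>, used with row indices in the F-points and column indices in the C-points.
\<close>

type_synonym 'n bvec = "nat \<Rightarrow> complex ^ 'n"
type_synonym 'n bmat = "nat \<Rightarrow> nat \<Rightarrow> complex ^ 'n ^ 'n"

definition bmult :: "nat set \<Rightarrow> 'n::finite bmat \<Rightarrow> 'n bmat \<Rightarrow> 'n bmat" where
  "bmult S M P = (\<lambda>i j. \<Sum>s\<in>S. M i s ** P s j)"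

definition bapply :: "nat set \<Rightarrow> 'n::finite bmat \<Rightarrow> 'n bvec \<Rightarrow> 'n bvec" where
  "bapply S M x = (\<lambda>i. \<Sum>s\<in>S. M i s *v x s)"

definition bident :: "'n::finite bmat" where
  "bident = (\<lambda>i j. if i = j then mat 1 else 0)"

definition binverse :: "nat set \<Rightarrow> 'n::finite bmat \<Rightarrow> 'n bmat" where
  "binverse S M = (THE X.
     (\<forall>i\<in>S. \<forall>j\<in>S. bmult S M X i j = bident i j \<and> bmult S X M i j = bident i j) \<and>
     (\<forall>i j. i \<notin> S \<or> j \<notin> S \<longrightarrow> X i j = 0))"

definition bidiag :: "complex ^ 'n ^ 'n \<Rightarrow> 'n::finite bmat" where
  "bidiag T = (\<lambda>i j. if i = j then mat 1 else if i = Suc j then - T else 0)"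

definition num_points :: "nat \<Rightarrow> nat \<Rightarrow> nat" where
  "num_points k Nc = (Nc - 1) * k + 1"

definition cpts :: "nat \<Rightarrow> nat \<Rightarrow> nat set" where
  "cpts k Nc = {j. j < num_points k Nc \<and> k dvd j}"

definition fpts :: "nat \<Rightarrow> nat \<Rightarrow> nat set" where
  "fpts k Nc = {j. j < num_points k Nc \<and> \<not> k dvd j}"

definition extension :: "nat \<Rightarrow> nat \<Rightarrow> complex ^ 'n ^ 'n \<Rightarrow> 'n::finite bmat" where
  \<comment> \<open>\<open>A\<^sub>f\<^sub>f\<^sup>-\<^sup>1 A\<^sub>f\<^sub>c\<close>\<close>
  "extension k Nc \<Phi> =
     bmult (fpts k Nc) (binverse (fpts k Nc) (bidiag \<Phi>)) (bidiag \<Phi>)"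

definition schur_correction :: "nat \<Rightarrow> nat \<Rightarrow> complex ^ 'n ^ 'n \<Rightarrow> 'n::finite bmat" where
  \<comment> \<open>\<open>A\<^sub>c\<^sub>f A\<^sub>f\<^sub>f\<^sup>-\<^sup>1 A\<^sub>f\<^sub>c\<close>\<close>
  "schur_correction k Nc \<Phi> = bmult (fpts k Nc) (bidiag \<Phi>) (extension k Nc \<Phi>)"

definition A_Delta :: "nat \<Rightarrow> nat \<Rightarrow> complex ^ 'n ^ 'n \<Rightarrow> 'n::finite bmat" where
  "A_Delta k Nc \<Phi> = bidiag \<Phi> - schur_correction k Nc \<Phi>"

definition B_Delta :: "nat \<Rightarrow> complex ^ 'n ^ 'n \<Rightarrow> 'n::finite bmat" where
  \<comment> \<open>C-points keep their fine-grid index, so the C-point \<open>i\<close> is number \<open>i div k\<close> on the coarse grid\<close>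
  "B_Delta k \<Psi> = (\<lambda>i j. bidiag \<Psi> (i div k) (j div k))"

definition left_factor :: "nat \<Rightarrow> nat \<Rightarrow> complex ^ 'n ^ 'n \<Rightarrow> 'n::finite bmat" where
  \<comment> \<open>the block column \<open>[- A\<^sub>f\<^sub>f\<^sup>-\<^sup>1 A\<^sub>f\<^sub>c; I]\<close>: rows are all time points, columns are C-points\<close>
  "left_factor k Nc \<Phi> =
     (\<lambda>i j. if i \<in> fpts k Nc then - extension k Nc \<Phi> i j else bident i j)"

definition right_factor ::
  "nat \<Rightarrow> nat \<Rightarrow> complex ^ 'n ^ 'n \<Rightarrow> complex ^ 'n ^ 'n \<Rightarrow> 'n::finite bmat" where
  \<comment> \<open>the block row \<open>[0, (I - B\<^sub>\<Delta>\<^sup>-\<^sup>1 A\<^sub>\<Delta>) A\<^sub>c\<^sub>f A\<^sub>f\<^sub>f\<^sup>-\<^sup>1 A\<^sub>f\<^sub>c]\<close>: rows are C-points, columns are all time points\<close>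
  "right_factor k Nc \<Phi> \<Psi> =
     (\<lambda>i j. if j \<in> fpts k Nc then 0
            else bmult (cpts k Nc)
                   (bident - bmult (cpts k Nc) (binverse (cpts k Nc) (B_Delta k \<Psi>)) (A_Delta k Nc \<Phi>))
                   (schur_correction k Nc \<Phi>) i j)"

definition E_FCF ::
  "nat \<Rightarrow> nat \<Rightarrow> complex ^ 'n ^ 'n \<Rightarrow> complex ^ 'n ^ 'n \<Rightarrow> 'n::finite bmat" where
  "E_FCF k Nc \<Phi> \<Psi> = bmult (cpts k Nc) (left_factor k Nc \<Phi>) (right_factor k Nc \<Phi> \<Psi>)"

definition mgrit_error ::
  "nat \<Rightarrow> complex ^ 'n ^ 'n \<Rightarrow> complex ^ 'n ^ 'n \<Rightarrow> nat \<Rightarrow> 'n::finite bvec \<Rightarrow> nat \<Rightarrow> 'n bvec" where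
  \<comment> \<open>the error after \<open>p\<close> iterations from the initial error \<open>e0\<close>\<close>
  "mgrit_error k \<Phi> \<Psi> Nc e0 p = (bapply {..<num_points k Nc} (E_FCF k Nc \<Phi> \<Psi>) ^^ p) e0"

definition l2_norm :: "nat \<Rightarrow> nat \<Rightarrow> 'n::finite bvec \<Rightarrow> real" where
  "l2_norm k Nc x = L2_set (\<lambda>j. norm (x j)) {..<num_points k Nc}"

definition U_norm :: "nat \<Rightarrow> complex ^ 'n ^ 'n \<Rightarrow> nat \<Rightarrow> 'n::finite bvec \<Rightarrow> real" where
  \<comment> \<open>the norm of index \<open>(U U\<^sup>*)\<^sup>-\<^sup>1\<close>\<close>
  "U_norm k U Nc x = l2_norm k Nc (\<lambda>j. matrix_inv U *v x j)"

definition AA_norm :: "nat \<Rightarrow> complex ^ 'n ^ 'n \<Rightarrow> nat \<Rightarrow> 'n::finite bvec \<Rightarrow> real" where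
  \<comment> \<open>the norm of index \<open>A\<^sup>* A\<close>\<close>
  "AA_norm k \<Phi> Nc x = l2_norm k Nc (bapply {..<num_points k Nc} (bidiag \<Phi>) x)"

definition mpow :: "complex ^ 'n ^ 'n \<Rightarrow> nat \<Rightarrow> complex ^ 'n::finite ^ 'n" where
  \<comment> \<open>\<open>*\<close> and \<open>^\<close> on the vector type are componentwise\<close>
  "mpow M q = (((**) M) ^^ q) (mat 1)"

definition diagonalized_by ::
  "complex ^ 'n ^ 'n \<Rightarrow> complex ^ 'n ^ 'n \<Rightarrow> ('n::finite \<Rightarrow> complex) \<Rightarrow> bool" where
  "diagonalized_by M U d \<longleftrightarrow> invertible U \<and> (\<forall>l. M *v column l U = d l *s column l U)"

definition fcf_teap :: "nat \<Rightarrow> ('n \<Rightarrow> complex) \<Rightarrow> ('n \<Rightarrow> complex) \<Rightarrow> real \<Rightarrow> bool" where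
  "fcf_teap k lam mu \<phi> \<longleftrightarrow>
     (\<forall>l. cmod (mu l - lam l ^ k) \<le> \<phi> * ((1 - cmod (mu l)) / cmod (lam l ^ k)))"

definition best_fcf_teap :: "nat \<Rightarrow> ('n \<Rightarrow> complex) \<Rightarrow> ('n \<Rightarrow> complex) \<Rightarrow> real \<Rightarrow> bool" where
  \<comment> \<open>A bound by \<open>\<phi>\<close> can only be tight, and \<open>\<phi> < 1\<close> only be necessary, for the least constant.\<close>
  "best_fcf_teap k lam mu \<phi> \<longleftrightarrow>
     fcf_teap k lam mu \<phi> \<and> (\<forall>\<phi>'. fcf_teap k lam mu \<phi>' \<longrightarrow> \<phi> \<le> \<phi>')"

definition asymp_convergent ::
  "nat \<Rightarrow> complex ^ 'n ^ 'n \<Rightarrow> complex ^ 'n ^ 'n \<Rightarrow> (nat \<Rightarrow> 'n::finite bvec \<Rightarrow> real) \<Rightarrow> bool" where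
  \<comment> \<open>The errors tend to zero relative to the initial error, uniformly in the number of coarse
     points. For a fixed \<open>Nc\<close> the propagator is nilpotent, so that convergence without the
     uniformity would hold for all \<open>\<Phi>\<close> and \<open>\<Psi>\<close>.\<close>
  "asymp_convergent k \<Phi> \<Psi> nrm \<longleftrightarrow>
     (\<forall>\<epsilon>>0. \<exists>P. \<forall>p\<ge>P. \<forall>Nc\<ge>1. \<forall>e0. nrm Nc (mgrit_error k \<Phi> \<Psi> Nc e0 p) \<le> \<epsilon> * nrm Nc e0)"

end

(* Conjugating by the block diagonal of U decouples the error propagation into one scalar problem per
   eigenvalue pair (l, m) of (Phi, Psi). On the C-points it becomes the lower triangular Toeplitz
   operator T with kernel c m^j shifted by two steps, where c = (l^k - m) l^k, and the TEAP says
   |c| <= phi (1 - |m|). Since z = T y satisfies z(j+2) - m z(j+1) = c y(j), T is bounded by bounding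
   its two-term inverse from below: with r = |m| and m = r w,
     |a - m b|^2 = (1-r) |a|^2 - r (1-r) |b|^2 + r |a - w b|^2,
   so that summing gives (1-r)^2 ||z||^2 plus r times a discrete Dirichlet energy with z(0) = 0, which
   the discrete Poincare inequality bounds below by ||z||^2 / Nc^2. For w-modulated hat functions the
   Dirichlet energy is of the order ||z||^2 / Nc^2, which makes them extremal up to that order. *)
theory Submission
  imports Defs
begin

section \<open>The scalar coarse-grid operator\<close>

text \<open>The upper bound iterates directly, but a sequence that is nearly extremal for one
  application of T says little about powers of T. Tightness is therefore obtained backwards: the
  final error is prescribed as a modulated hat, and the initial error is its preimage under p+1
  applications. The two-term inverse S is local, so preimages of a sequence with enough zeros at
  both ends are explicit and stay inside the grid. Each S multiplies the squared norm by 1/phi^2 up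
  to a multiple of the Dirichlet energy; since S commutes with the twisted difference, that energy
  grows at most by 4/|c|^2 per step, whatever Nc is. A second obstacle is the fine-grid norm:
  F-relaxation weights a coarse value by the sum of |l|^(2r) over r < k, except at the last C-point,
  which has weight one. The last entry of an argument never reaches the image inside the grid, and
  the hats vanish there, so neither bound suffers. The size of the gap is governed by the smallest
  |m|, positive because Psi is invertible.\<close>

lemma norm_diff_mult_sq:
  fixes a b \<omega> :: complex and r :: real
  assumes "cmod \<omega> = 1"
  shows "(cmod (a - of_real r * \<omega> * b))\<^sup>2
    = (1 - r) * (cmod a)\<^sup>2 - r * (1 - r) * (cmod b)\<^sup>2 + r * (cmod (a - \<omega> * b))\<^sup>2"
proof -
  have w: "(Re \<omega>)\<^sup>2 + (Im \<omega>)\<^sup>2 = 1"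
    using assms by (metis cmod_power2 one_power2)
  have *: "(cmod (\<omega> * b))\<^sup>2 = (cmod b)\<^sup>2"
    using assms by (simp add: norm_mult)
  have "(cmod (a - of_real r * c))\<^sup>2
    = (1 - r) * (cmod a)\<^sup>2 - r * (1 - r) * (cmod c)\<^sup>2 + r * (cmod (a - c))\<^sup>2" for c
    unfolding cmod_power2 by (simp add: power2_eq_square algebra_simps)
  from this[of "\<omega> * b"] show ?thesis by (simp add: * mult.assoc)
qed

lemma complex_polar_obtain:
  fixes \<mu> :: complex
  obtains \<omega> where "cmod \<omega> = 1" "\<mu> = of_real (cmod \<mu>) * \<omega>"
  by (metis norm_cis rcis_cmod_Arg rcis_def)

text \<open>Splitting 1 - r as (1-r)^2 + r (1-r) makes the r (1-r) terms telescope;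
  \<open>z 0 = 0\<close> removes the lower boundary term and the upper one remains, with a
  favourable sign when 0 \<le> r \<le> 1.\<close>

lemma sum_norm_diff_mult_sq:
  fixes z :: "nat \<Rightarrow> complex"
  assumes "cmod \<omega> = 1" "\<mu> = of_real r * \<omega>" "z 0 = 0"
  shows "(\<Sum>m<n. (cmod (z (Suc m) - \<mu> * z m))\<^sup>2)
    = (1 - r)\<^sup>2 * (\<Sum>m<Suc n. (cmod (z m))\<^sup>2) + r * (1 - r) * (cmod (z n))\<^sup>2
      + r * (\<Sum>m<n. (cmod (z (Suc m) - \<omega> * z m))\<^sup>2)"
proof (induction n)
  case 0
  then show ?case using assms by simp
next
  case (Suc n)
  have *: "(cmod (z (Suc n) - \<mu> * z n))\<^sup>2
    = (1 - r)\<^sup>2 * (cmod (z (Suc n)))\<^sup>2 + r * (1 - r) * (cmod (z (Suc n)))\<^sup>2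
      - r * (1 - r) * (cmod (z n))\<^sup>2 + r * (cmod (z (Suc n) - \<omega> * z n))\<^sup>2"
    using norm_diff_mult_sq[OF assms(1), of "z (Suc n)" r "z n"] assms(2)
    by (simp add: power2_eq_square algebra_simps)
  have "(\<Sum>m<Suc n. (cmod (z (Suc m) - \<mu> * z m))\<^sup>2)
    = (\<Sum>m<n. (cmod (z (Suc m) - \<mu> * z m))\<^sup>2) + (cmod (z (Suc n) - \<mu> * z n))\<^sup>2" by simp
  also have "\<dots> = (1 - r)\<^sup>2 * ((\<Sum>m<Suc n. (cmod (z m))\<^sup>2) + (cmod (z (Suc n)))\<^sup>2)
      + r * (1 - r) * (cmod (z (Suc n)))\<^sup>2
      + r * ((\<Sum>m<n. (cmod (z (Suc m) - \<omega> * z m))\<^sup>2) + (cmod (z (Suc n) - \<omega> * z n))\<^sup>2)"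
    unfolding Suc.IH * by (simp only: ring_distribs)
  finally show ?case by simp
qed

text \<open>Rotation by \<open>\<omega>\<close> preserves the modulus, so each |z m| is at most the
  sum of the preceding twisted increments; Cauchy-Schwarz does the rest. The constant is crude, only
  its order in N matters.\<close>

lemma discrete_poincare:
  fixes z :: "nat \<Rightarrow> complex"
  assumes "cmod \<omega> = 1" "z 0 = 0" "N \<ge> 1"
  shows "(\<Sum>m<N. (cmod (z m))\<^sup>2) \<le> (real N)\<^sup>2 * (\<Sum>m<N-1. (cmod (z (Suc m) - \<omega> * z m))\<^sup>2)"
    (is "_ \<le> _ * ?D")
proof -
  have lin: "cmod (z m) \<le> (\<Sum>j<m. cmod (z (Suc j) - \<omega> * z j))" for m
  proof (induction m)
    case (Suc m)
    have "cmod (z (Suc m)) \<le> cmod (z (Suc m) - \<omega> * z m) + cmod (\<omega> * z m)"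
      by (metis diff_add_cancel norm_triangle_ineq)
    with Suc assms(1) show ?case by (simp add: norm_mult)
  qed (simp add: assms)
  have "(cmod (z m))\<^sup>2 \<le> real N * ?D" if "m < N" for m
  proof -
    have "(cmod (z m))\<^sup>2 \<le> (\<Sum>j<m. cmod (z (Suc j) - \<omega> * z j))\<^sup>2"
      using lin by (simp add: power_mono)
    also have "\<dots> \<le> real m * (\<Sum>j<m. (cmod (z (Suc j) - \<omega> * z j))\<^sup>2)"
      using sum_squared_le_sum_of_squares[of "\<lambda>j. cmod (z (Suc j) - \<omega> * z j)" "{..<m}"]
      by (simp add: mult.commute)
    also have "\<dots> \<le> real N * ?D"
      using that by (intro mult_mono sum_mono2 sum_nonneg) auto
    finally show ?thesis .
  qed
  then have "(\<Sum>m<N. (cmod (z m))\<^sup>2) \<le> (\<Sum>m<N. real N * ?D)"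
    by (intro sum_mono) auto
  then show ?thesis by (simp add: power2_eq_square mult.assoc)
qed

text \<open>The operator acts on infinite sequences: being causal, it restricts to the finite grid
  of every size, so that no truncation to \<open>Nc\<close> has to be carried along. The truncated
  subtraction makes the sum empty at m = 0 and m = 1.\<close>

definition coarse_op :: "complex \<Rightarrow> complex \<Rightarrow> (nat \<Rightarrow> complex) \<Rightarrow> nat \<Rightarrow> complex" where
  "coarse_op c \<mu> y m = c * (\<Sum>n<m-1. \<mu> ^ (m - 2 - n) * y n)"

lemma coarse_op_0 [simp]: "coarse_op c \<mu> y 0 = 0" "coarse_op c \<mu> y (Suc 0) = 0"
  by (simp_all add: coarse_op_def)

lemma coarse_op_Suc_Suc:
  "coarse_op c \<mu> y (Suc (Suc m)) = \<mu> * coarse_op c \<mu> y (Suc m) + c * y m"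
proof -
  have "(\<Sum>n<m. \<mu> ^ (m - n) * y n) = \<mu> * (\<Sum>n<m. \<mu> ^ (Suc m - 2 - n) * y n)"
    unfolding sum_distrib_left
  proof (rule sum.cong)
    fix n assume "n \<in> {..<m}"
    then have "m - n = Suc (Suc m - 2 - n)" by auto
    then show "\<mu> ^ (m - n) * y n = \<mu> * (\<mu> ^ (Suc m - 2 - n) * y n)"
      by (metis mult.assoc power_Suc)
  qed simp
  then show ?thesis
    by (simp add: coarse_op_def algebra_simps)
qed

text \<open>Causality, with a delay of two: sequences that agree on the grid have images that agree
  on the grid.\<close>

lemma coarse_op_cong:
  "(\<And>n. n + 1 < m \<Longrightarrow> x n = y n) \<Longrightarrow> coarse_op c \<mu> x m = coarse_op c \<mu> y m"
  unfolding coarse_op_def by (intro arg_cong2[where f = "(*)"] sum.cong) auto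

text \<open>The two-term differences of the image are c times the delayed argument, so the summed
  identity and the Poincare inequality apply. Only entries of y below N-2 reach the first N entries
  of the image; this later absorbs the smaller weight of the last C-point.\<close>

lemma coarse_op_norm_le:
  assumes "cmod \<mu> < 1" "cmod c \<le> \<phi> * (1 - cmod \<mu>)" "N \<ge> 1"
  shows "(\<Sum>m<N. (cmod (coarse_op c \<mu> y m))\<^sup>2)
    \<le> \<phi>\<^sup>2 * (1 - cmod \<mu> / (real N)\<^sup>2) * (\<Sum>m<N-2. (cmod (y m))\<^sup>2)"
proof -
  define z r where "z = coarse_op c \<mu> y" and "r = cmod \<mu>"
  define Z Y where "Z = (\<Sum>m<N. (cmod (z m))\<^sup>2)" and "Y = (\<Sum>m<N-2. (cmod (y m))\<^sup>2)"
  obtain \<omega> where \<omega>: "cmod \<omega> = 1" "\<mu> = of_real r * \<omega>"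
    unfolding r_def by (rule complex_polar_obtain)
  have r: "0 \<le> r" "r < 1" using assms by (auto simp: r_def)
  \<comment> \<open>The difference at index 0 vanishes because z starts with two zeros, which leaves
    exactly N-2 terms.\<close>
  have "(\<Sum>m<N-1. (cmod (z (Suc m) - \<mu> * z m))\<^sup>2) = (cmod c)\<^sup>2 * Y"
  proof (cases "N \<ge> 2")
    case True
    then obtain M where N: "N = Suc (Suc M)" by (metis One_nat_def Suc_1 Suc_le_D le_SucE)
    show ?thesis
      by (simp add: N Y_def sum.lessThan_Suc_shift z_def coarse_op_Suc_Suc norm_mult
          power_mult_distrib sum_distrib_left del: sum.lessThan_Suc)
  next
    case False
    with assms show ?thesis by (simp add: Y_def)
  qed
  moreover have "(\<Sum>m<N-1. (cmod (z (Suc m) - \<mu> * z m))\<^sup>2) \<ge> (1 - r)\<^sup>2 * Z + r * (Z / (real N)\<^sup>2)"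
  proof -
    have "Z / (real N)\<^sup>2 \<le> (\<Sum>m<N-1. (cmod (z (Suc m) - \<omega> * z m))\<^sup>2)"
      using discrete_poincare[OF \<omega>(1), of z N] assms(3)
      by (simp add: Z_def z_def divide_le_eq mult.commute)
    then have "r * (Z / (real N)\<^sup>2) \<le> r * (\<Sum>m<N-1. (cmod (z (Suc m) - \<omega> * z m))\<^sup>2)"
      using r by (intro mult_left_mono)
    moreover have "0 \<le> r * (1 - r) * (cmod (z (N-1)))\<^sup>2" using r by simp
    ultimately show ?thesis
      using sum_norm_diff_mult_sq[OF \<omega>, of z "N-1"] assms(3) by (simp add: Z_def z_def)
  qed
  moreover have "(cmod c)\<^sup>2 * Y \<le> (\<phi> * (1 - r))\<^sup>2 * Y"
    using assms by (intro mult_right_mono power_mono) (auto simp: r_def Y_def sum_nonneg)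
  ultimately have main: "((1 - r)\<^sup>2 + r / (real N)\<^sup>2) * Z \<le> \<phi>\<^sup>2 * (1 - r)\<^sup>2 * Y"
    by (simp add: distrib_right power_mult_distrib)
  define t where "t = r / (real N)\<^sup>2"
  have N1: "1 \<le> (real N)\<^sup>2" using assms(3) by simp
  have t: "0 \<le> t" "t \<le> r"
    using r N1 by (auto simp: t_def divide_le_eq mult_le_cancel_left1)
  \<comment> \<open>This linearizes the quotient of (1-r)^2 by (1-r)^2 + t, which is at most 1 - t
    because the denominator is at most 1.\<close>
  have q: "(1 - r)\<^sup>2 \<le> (1 - t) * ((1 - r)\<^sup>2 + t)"
  proof -
    have "(1 - t) * ((1 - r)\<^sup>2 + t) - (1 - r)\<^sup>2 = t * (1 - (1 - r)\<^sup>2 - t)"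
      by (simp add: algebra_simps power2_eq_square)
    moreover have "(1 - r)\<^sup>2 + t \<le> 1"
    proof -
      have "r * r \<le> r" using r by (simp add: mult_left_le)
      then show ?thesis using t by (simp add: power2_eq_square algebra_simps)
    qed
    ultimately show ?thesis using t by (smt (verit) mult_nonneg_nonneg)
  qed
  have "Y \<ge> 0" by (simp add: Y_def sum_nonneg)
  have "((1 - r)\<^sup>2 + t) * Z \<le> \<phi>\<^sup>2 * Y * (1 - r)\<^sup>2"
    using main by (simp add: t_def algebra_simps)
  also have "\<dots> \<le> \<phi>\<^sup>2 * Y * ((1 - t) * ((1 - r)\<^sup>2 + t))"
    using q \<open>Y \<ge> 0\<close> by (intro mult_left_mono) auto
  also have "\<dots> = ((1 - r)\<^sup>2 + t) * (\<phi>\<^sup>2 * (1 - t) * Y)" by (simp add: algebra_simps)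
  finally have "Z \<le> \<phi>\<^sup>2 * (1 - t) * Y"
    using r t by (smt (verit) mult_le_cancel_left_pos zero_less_power)
  then show ?thesis by (simp add: Z_def Y_def z_def t_def r_def)
qed

section \<open>Explicit preimages and near-extremal sequences\<close>

definition coarse_inv :: "complex \<Rightarrow> complex \<Rightarrow> (nat \<Rightarrow> complex) \<Rightarrow> nat \<Rightarrow> complex" where
  "coarse_inv c \<mu> z m = (z (m + 2) - \<mu> * z (m + 1)) / c"

text \<open>The recurrence determines a sequence from its first two entries, which are zero on both
  sides. Being of second order, it needs induction on two neighbouring values at once.\<close>

lemma coarse_op_coarse_inv:
  assumes "c \<noteq> 0" "z 0 = 0" "z 1 = 0"
  shows "coarse_op c \<mu> (coarse_inv c \<mu> z) = z"
proof
  fix m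
  have "coarse_op c \<mu> (coarse_inv c \<mu> z) m = z m
    \<and> coarse_op c \<mu> (coarse_inv c \<mu> z) (Suc m) = z (Suc m)"
    by (induction m) (use assms in \<open>auto simp: coarse_op_Suc_Suc coarse_inv_def\<close>)
  then show "coarse_op c \<mu> (coarse_inv c \<mu> z) m = z m" by simp
qed

text \<open>Each preimage moves the support two places to the left, so every further one uses up two
  leading zeros.\<close>

lemma coarse_inv_pow_eq_0_below:
  assumes "\<And>m. m < a + 2 * j \<Longrightarrow> z m = 0" "m < a"
  shows "(coarse_inv c \<mu> ^^ j) z m = 0"
  using assms
proof (induction j arbitrary: a m)
  case (Suc j)
  have "(coarse_inv c \<mu> ^^ j) z n = 0" if "n < a + 2" for n
    using Suc.prems that by (intro Suc.IH[of "a + 2"]) auto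
  from this[of "m + 2"] this[of "m + 1"] \<open>m < a\<close> show ?case
    by (simp add: coarse_inv_def[of _ _ "(coarse_inv c \<mu> ^^ j) z"])
qed simp

lemma coarse_inv_pow_eq_0_above:
  assumes "\<And>m. m \<ge> b \<Longrightarrow> z m = 0" "m \<ge> b"
  shows "(coarse_inv c \<mu> ^^ j) z m = 0"
  using assms(2) by (induction j arbitrary: m) (auto simp: assms(1) coarse_inv_def)

text \<open>Iterates started at a deep preimage are shallower preimages of the same z, which gives
  all intermediate errors in closed form. The zeros of z ensure that each of them starts with two
  zeros, as the right inverse requires.\<close>

lemma coarse_op_pow_coarse_inv_pow:
  assumes "c \<noteq> 0" "\<And>m. m < 2 * (i + j) \<Longrightarrow> z m = 0"
  shows "(coarse_op c \<mu> ^^ j) ((coarse_inv c \<mu> ^^ (i + j)) z) = (coarse_inv c \<mu> ^^ i) z"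
  using assms(2)
proof (induction j)
  case (Suc j)
  have "(coarse_inv c \<mu> ^^ (i + j)) z m = 0" if "m < 2" for m
    using Suc.prems that by (intro coarse_inv_pow_eq_0_below[of 2]) auto
  then have "coarse_op c \<mu> ((coarse_inv c \<mu> ^^ (i + Suc j)) z) = (coarse_inv c \<mu> ^^ (i + j)) z"
    using assms(1) by (simp add: coarse_op_coarse_inv)
  then show ?case using Suc by (simp add: funpow_swap1)
qed simp

lemma sum_shift_eq:
  fixes f :: "nat \<Rightarrow> real"
  assumes "\<And>m. m < d \<Longrightarrow> f m = 0" "\<And>m. m \<ge> N \<Longrightarrow> f m = 0"
  shows "(\<Sum>m<N. f (m + d)) = (\<Sum>m<N. f m)"
proof -
  have "(\<Sum>m<N. f (m + d)) = (\<Sum>m\<in>{d..<N+d}. f m)"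
    using sum.shift_bounds_nat_ivl[of f 0 d N] by (simp add: lessThan_atLeast0)
  also have "\<dots> = (\<Sum>m<N. f m)"
    by (rule sum.mono_neutral_cong) (use assms in \<open>auto simp: not_less\<close>)
  finally show ?thesis .
qed

text \<open>The zeros at the right end remove the remaining boundary term, so the norm of a preimage
  is known exactly in terms of norm and Dirichlet energy.\<close>

lemma coarse_inv_norm_eq:
  assumes "c \<noteq> 0" "cmod \<omega> = 1" "\<mu> = of_real r * \<omega>" "N \<ge> 1"
    "z 0 = 0" "z 1 = 0" "\<And>m. m \<ge> N - 1 \<Longrightarrow> z m = 0"
  shows "(\<Sum>m<N. (cmod (coarse_inv c \<mu> z m))\<^sup>2)
    = ((1 - r)\<^sup>2 * (\<Sum>m<N. (cmod (z m))\<^sup>2)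
       + r * (\<Sum>m<N. (cmod (z (Suc m) - \<omega> * z m))\<^sup>2)) / (cmod c)\<^sup>2"
proof -
  have z: "z m = 0" if "m \<ge> N - 1" for m using that assms by blast
  have "(\<Sum>m<N. (cmod (coarse_inv c \<mu> z m))\<^sup>2)
    = (\<Sum>m<N. (cmod (z (Suc (m + 1)) - \<mu> * z (m + 1)))\<^sup>2) / (cmod c)\<^sup>2"
    by (simp add: coarse_inv_def norm_divide power_divide sum_divide_distrib)
  also have "(\<Sum>m<N. (cmod (z (Suc (m + 1)) - \<mu> * z (m + 1)))\<^sup>2)
    = (\<Sum>m<N. (cmod (z (Suc m) - \<mu> * z m))\<^sup>2)"
    by (rule sum_shift_eq) (use assms z in auto)
  also have "\<dots> = (1 - r)\<^sup>2 * (\<Sum>m<N. (cmod (z m))\<^sup>2)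
       + r * (\<Sum>m<N. (cmod (z (Suc m) - \<omega> * z m))\<^sup>2)"
    using sum_norm_diff_mult_sq[of \<omega> \<mu> r z N] assms(2,3,5) z[of N] by simp
  finally show ?thesis .
qed

text \<open>The inverse commutes with the twisted difference u, so u undergoes the same two-term
  map. The factor 4 is (1 + 1)^2 from |\<mu>| \<le> 1; a crude constant suffices because the energy
  is already of lower order.\<close>

lemma coarse_inv_diff_norm_le:
  assumes "cmod \<mu> \<le> 1" "\<And>m. m \<ge> N \<Longrightarrow> z m = 0"
  shows "(\<Sum>m<N. (cmod (coarse_inv c \<mu> z (Suc m) - \<omega> * coarse_inv c \<mu> z m))\<^sup>2)
    \<le> 4 / (cmod c)\<^sup>2 * (\<Sum>m<N. (cmod (z (Suc m) - \<omega> * z m))\<^sup>2)"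
proof -
  define u where "u m = z (Suc m) - \<omega> * z m" for m
  have u0: "u m = 0" if "m \<ge> N" for m using assms(2) that by (simp add: u_def)
  have shift: "(\<Sum>m<N. (cmod (u (m + d)))\<^sup>2) \<le> (\<Sum>m<N. (cmod (u m))\<^sup>2)" for d
  proof -
    have "(\<Sum>m<N. (cmod (u (m + d)))\<^sup>2) = (\<Sum>m\<in>{d..<N+d}. (cmod (u m))\<^sup>2)"
      using sum.shift_bounds_nat_ivl[of "\<lambda>m. (cmod (u m))\<^sup>2" 0 d N] by (simp add: lessThan_atLeast0)
    also have "\<dots> \<le> (\<Sum>m\<in>{..<N+d}. (cmod (u m))\<^sup>2)" by (rule sum_mono2) auto
    also have "\<dots> = (\<Sum>m<N. (cmod (u m))\<^sup>2)"
      by (rule sum.mono_neutral_right) (use u0 in auto)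
    finally show ?thesis .
  qed
  have pt: "(cmod (coarse_inv c \<mu> z (Suc m) - \<omega> * coarse_inv c \<mu> z m))\<^sup>2
    \<le> (2 * (cmod (u (m + 2)))\<^sup>2 + 2 * (cmod (u (m + 1)))\<^sup>2) / (cmod c)\<^sup>2" for m
  proof -
    have eq: "coarse_inv c \<mu> z (Suc m) - \<omega> * coarse_inv c \<mu> z m = (u (m + 2) - \<mu> * u (m + 1)) / c"
      by (simp add: coarse_inv_def u_def divide_simps) (simp add: algebra_simps)
    have "cmod (u (m + 2) - \<mu> * u (m + 1)) \<le> cmod (u (m + 2)) + cmod (\<mu> * u (m + 1))"
      by (rule norm_triangle_ineq4)
    also have "\<dots> \<le> cmod (u (m + 2)) + cmod (u (m + 1))"
      using assms(1) by (simp add: norm_mult mult_left_le_one_le)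
    finally have "(cmod (u (m + 2) - \<mu> * u (m + 1)))\<^sup>2 \<le> (cmod (u (m + 2)) + cmod (u (m + 1)))\<^sup>2"
      by (simp add: power_mono)
    also have "\<dots> \<le> 2 * (cmod (u (m + 2)))\<^sup>2 + 2 * (cmod (u (m + 1)))\<^sup>2"
      using sum_squares_bound[of "cmod (u (m + 2))" "cmod (u (m + 1))"]
      by (simp add: power2_sum)
    finally show ?thesis unfolding eq by (simp add: norm_divide power_divide divide_right_mono)
  qed
  have "(\<Sum>m<N. (cmod (coarse_inv c \<mu> z (Suc m) - \<omega> * coarse_inv c \<mu> z m))\<^sup>2)
    \<le> (\<Sum>m<N. (2 * (cmod (u (m + 2)))\<^sup>2 + 2 * (cmod (u (m + 1)))\<^sup>2) / (cmod c)\<^sup>2)"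
    by (intro sum_mono pt)
  also have "\<dots> = (2 * (\<Sum>m<N. (cmod (u (m + 2)))\<^sup>2) + 2 * (\<Sum>m<N. (cmod (u (m + 1)))\<^sup>2)) / (cmod c)\<^sup>2"
    by (simp only: sum_divide_distrib[symmetric] sum.distrib sum_distrib_left)
  also have "\<dots> \<le> (4 * (\<Sum>m<N. (cmod (u m))\<^sup>2)) / (cmod c)\<^sup>2"
    using shift[of 2] shift[of 1] by (intro divide_right_mono) auto
  finally show ?thesis by (simp add: u_def)
qed

lemma coarse_inv_pow_diff_norm_le:
  assumes "cmod \<mu> \<le> 1" "\<And>m. m \<ge> N \<Longrightarrow> z m = 0"
  shows "(\<Sum>m<N. (cmod ((coarse_inv c \<mu> ^^ j) z (Suc m) - \<omega> * (coarse_inv c \<mu> ^^ j) z m))\<^sup>2)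
    \<le> (4 / (cmod c)\<^sup>2) ^ j * (\<Sum>m<N. (cmod (z (Suc m) - \<omega> * z m))\<^sup>2)"
proof (induction j)
  case (Suc j)
  have "(\<Sum>m<N. (cmod ((coarse_inv c \<mu> ^^ Suc j) z (Suc m) - \<omega> * (coarse_inv c \<mu> ^^ Suc j) z m))\<^sup>2)
    \<le> 4 / (cmod c)\<^sup>2 *
      (\<Sum>m<N. (cmod ((coarse_inv c \<mu> ^^ j) z (Suc m) - \<omega> * (coarse_inv c \<mu> ^^ j) z m))\<^sup>2)"
    using coarse_inv_diff_norm_le[OF assms(1), of N "(coarse_inv c \<mu> ^^ j) z"]
      coarse_inv_pow_eq_0_above[of N z] assms(2) by simp
  also have "\<dots> \<le> 4 / (cmod c)\<^sup>2 *
      ((4 / (cmod c)\<^sup>2) ^ j * (\<Sum>m<N. (cmod (z (Suc m) - \<omega> * z m))\<^sup>2))"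
    using Suc by (intro mult_left_mono) auto
  finally show ?case by (simp add: mult.assoc)
qed simp

text \<open>With |c| equal to its extreme value, the leading factor (1-r)^2 / |c|^2 of each step is
  exactly 1 / \<phi>^2. What matters is the order of the quantifiers: K is independent of N and
  z.\<close>

lemma coarse_inv_pow_norm_le:
  assumes "\<phi> > 0" "cmod \<mu> < 1" "cmod c = \<phi> * (1 - cmod \<mu>)"
    "cmod \<omega> = 1" "\<mu> = of_real (cmod \<mu>) * \<omega>"
  shows "\<exists>K\<ge>0. \<forall>N\<ge>1. \<forall>z. (\<forall>m. m < 2 * j \<longrightarrow> z m = 0) \<longrightarrow> (\<forall>m\<ge>N-1. z m = 0) \<longrightarrow>
    (\<Sum>m<N. (cmod ((coarse_inv c \<mu> ^^ j) z m))\<^sup>2)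
     \<le> (1 / \<phi> ^ (2 * j)) * (\<Sum>m<N. (cmod (z m))\<^sup>2) + K * (\<Sum>m<N. (cmod (z (Suc m) - \<omega> * z m))\<^sup>2)"
proof (induction j)
  case 0
  show ?case by (rule exI[of _ 0]) simp
next
  case (Suc j)
  define r where "r = cmod \<mu>"
  have r: "0 \<le> r" "r < 1" using assms by (auto simp: r_def)
  have c: "c \<noteq> 0" "(cmod c)\<^sup>2 = \<phi>\<^sup>2 * (1 - r)\<^sup>2" using assms by (auto simp: r_def power_mult_distrib)
  from Suc obtain K where K: "K \<ge> 0" and IH: "\<And>N z. N \<ge> 1 \<Longrightarrow> (\<And>m. m < 2 * j \<Longrightarrow> z m = 0) \<Longrightarrow>
    (\<And>m. m \<ge> N-1 \<Longrightarrow> z m = 0) \<Longrightarrow>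
    (\<Sum>m<N. (cmod ((coarse_inv c \<mu> ^^ j) z m))\<^sup>2)
     \<le> (1 / \<phi> ^ (2 * j)) * (\<Sum>m<N. (cmod (z m))\<^sup>2) + K * (\<Sum>m<N. (cmod (z (Suc m) - \<omega> * z m))\<^sup>2)"
    by blast
  \<comment> \<open>The first summand is the inherited error term after one more step, the second
    the energy of the j-th preimage.\<close>
  define K' where "K' = K / \<phi>\<^sup>2 + r / (cmod c)\<^sup>2 * (4 / (cmod c)\<^sup>2) ^ j"
  show ?case
  proof (intro exI[of _ K'] conjI allI impI)
    show "K' \<ge> 0" using K r by (simp add: K'_def)
    fix N z assume N: "(1::nat) \<le> N" and lo: "\<forall>m<2 * Suc j. z m = (0::complex)"
      and hi: "\<forall>m\<ge>N - 1. z m = 0"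
    define v where "v = (coarse_inv c \<mu> ^^ j) z"
    define B D where "B = (\<Sum>m<N. (cmod (z m))\<^sup>2)" and "D = (\<Sum>m<N. (cmod (z (Suc m) - \<omega> * z m))\<^sup>2)"
    have v0: "v m = 0" if "m < 2" for m
      unfolding v_def using lo that by (intro coarse_inv_pow_eq_0_below[of 2]) auto
    have v1: "v m = 0" if "m \<ge> N - 1" for m
      unfolding v_def using hi that by (intro coarse_inv_pow_eq_0_above[of "N - 1"]) auto
    have Dv: "(\<Sum>m<N. (cmod (v (Suc m) - \<omega> * v m))\<^sup>2) \<le> (4 / (cmod c)\<^sup>2) ^ j * D"
      unfolding v_def D_def using assms hi by (intro coarse_inv_pow_diff_norm_le) auto
    have Bv: "(\<Sum>m<N. (cmod (v m))\<^sup>2) \<le> (1 / \<phi> ^ (2 * j)) * B + K * D"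
      unfolding v_def B_def D_def using lo hi N by (intro IH) auto
    have "(\<Sum>m<N. (cmod ((coarse_inv c \<mu> ^^ Suc j) z m))\<^sup>2)
      = (\<Sum>m<N. (cmod (coarse_inv c \<mu> v m))\<^sup>2)" by (simp add: v_def)
    also have "\<dots> = (1 - r)\<^sup>2 / (cmod c)\<^sup>2 * (\<Sum>m<N. (cmod (v m))\<^sup>2)
       + r / (cmod c)\<^sup>2 * (\<Sum>m<N. (cmod (v (Suc m) - \<omega> * v m))\<^sup>2)"
      using coarse_inv_norm_eq[OF c(1) assms(4,5) N, of v] v0 v1
      by (simp add: r_def add_divide_distrib)
    also have "(1 - r)\<^sup>2 / (cmod c)\<^sup>2 = 1 / \<phi>\<^sup>2" using c r by simp
    also have "1 / \<phi>\<^sup>2 * (\<Sum>m<N. (cmod (v m))\<^sup>2)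
       + r / (cmod c)\<^sup>2 * (\<Sum>m<N. (cmod (v (Suc m) - \<omega> * v m))\<^sup>2)
      \<le> 1 / \<phi>\<^sup>2 * ((1 / \<phi> ^ (2 * j)) * B + K * D) + r / (cmod c)\<^sup>2 * ((4 / (cmod c)\<^sup>2) ^ j * D)"
      using r Bv Dv by (intro add_mono mult_left_mono) auto
    also have "\<dots> = 1 / \<phi> ^ (2 * Suc j) * B + K' * D"
      using assms(1) by (simp add: K'_def field_simps power2_eq_square)
    finally show "(\<Sum>m<N. (cmod ((coarse_inv c \<mu> ^^ Suc j) z m))\<^sup>2) \<le>
       1 / \<phi> ^ (2 * Suc j) * (\<Sum>m<N. (cmod (z m))\<^sup>2) + K' * (\<Sum>m<N. (cmod (z (Suc m) - \<omega> * z m))\<^sup>2)"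
      unfolding B_def D_def .
  qed
qed

text \<open>The hat has slope 1, support between a and a + 4 L, and height 2 L. It is at least L on
  L consecutive points, so its squared norm is at least L^3, while its energy is at most N. As N
  \<le> 16 L, the constant is 16^3 = 4096.\<close>

lemma hat_function:
  fixes a N :: nat
  assumes "N \<ge> 8 * (a + 2)"
  shows "\<exists>h :: nat \<Rightarrow> real. (\<forall>m<a. h m = 0) \<and> (\<forall>m\<ge>N-1. h m = 0) \<and> (\<Sum>m<N. (h m)\<^sup>2) > 0
    \<and> (\<Sum>m<N. (h (Suc m) - h m)\<^sup>2) \<le> 4096 / (real N)\<^sup>2 * (\<Sum>m<N. (h m)\<^sup>2)"
proof -
  define L where "L = N div 8"
  define h :: "nat \<Rightarrow> real" where
    "h m = max 0 (min (real m - real a) (real a + 4 * real L - real m))" for m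
  have L: "L \<ge> 1" "a + 4 * L + 1 \<le> N" "N \<le> 16 * L"
    using assms unfolding L_def by auto
  have diff: "(h (Suc m) - h m)\<^sup>2 \<le> 1" for m
    unfolding abs_square_le_1 by (auto simp: h_def max_def min_def)
  have "(\<Sum>m\<in>{a+L..<a+2*L}. (real L)\<^sup>2) \<le> (\<Sum>m<N. (h m)\<^sup>2)"
  proof (rule order_trans)
    show "(\<Sum>m\<in>{a+L..<a+2*L}. (real L)\<^sup>2) \<le> (\<Sum>m\<in>{a+L..<a+2*L}. (h m)\<^sup>2)"
    proof (intro sum_mono power_mono)
      fix m assume "m \<in> {a+L..<a+2*L}"
      then have "a + L \<le> m" "m < a + 2 * L" by auto
      then have "real L + real a \<le> real m" "real m \<le> real a + 2 * real L" by linarith+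
      then show "real L \<le> h m" by (simp add: h_def)
    qed simp
    show "(\<Sum>m\<in>{a+L..<a+2*L}. (h m)\<^sup>2) \<le> (\<Sum>m<N. (h m)\<^sup>2)"
      using L by (intro sum_mono2) auto
  qed
  then have big: "real L ^ 3 \<le> (\<Sum>m<N. (h m)\<^sup>2)"
    by (simp add: power3_eq_cube power2_eq_square)
  have "(\<Sum>m<N. (h (Suc m) - h m)\<^sup>2) \<le> (\<Sum>m<N. 1)" by (intro sum_mono diff)
  then have "(\<Sum>m<N. (h (Suc m) - h m)\<^sup>2) * (real N)\<^sup>2 \<le> real N * (real N)\<^sup>2"
    by (intro mult_right_mono) auto
  also have "\<dots> = real N ^ 3" by (simp add: power3_eq_cube power2_eq_square)
  also have "\<dots> \<le> (16 * real L) ^ 3"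
    using L(3) by (intro power_mono) linarith+
  also have "\<dots> = 4096 * real L ^ 3" by (simp add: power_mult_distrib)
  also have "\<dots> \<le> 4096 * (\<Sum>m<N. (h m)\<^sup>2)" using big by simp
  finally have "(\<Sum>m<N. (h (Suc m) - h m)\<^sup>2) \<le> 4096 / (real N)\<^sup>2 * (\<Sum>m<N. (h m)\<^sup>2)"
    using L by (simp add: field_simps)
  moreover have "(\<Sum>m<N. (h m)\<^sup>2) > 0"
    using big L(1) by (smt (verit) of_nat_1 of_nat_mono zero_less_power)
  moreover have "h m = 0" if "m < a" for m
    using that by (simp add: h_def)
  moreover have "h m = 0" if "m \<ge> N - 1" for m
    using that L by (simp add: h_def)
  ultimately show ?thesis by blast
qed

text \<open>One sequence and one C serve all i \<le> j, since both the initial and the first error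
  will be compared with the final one. The threshold on N is that of a hat with 2 j + 2 leading
  zeros.\<close>

lemma near_extremal_sequence:
  assumes "\<phi> > 0" "cmod \<mu> < 1" "cmod c = \<phi> * (1 - cmod \<mu>)"
  shows "\<exists>C\<ge>0. \<forall>N\<ge>8 * (2 * j + 4). \<exists>z. (\<forall>m < 2 * j + 2. z m = 0) \<and> (\<forall>m\<ge>N-1. z m = 0)
    \<and> (\<Sum>m<N. (cmod (z m))\<^sup>2) > 0
    \<and> (\<forall>i\<le>j. (\<Sum>m<N. (cmod ((coarse_inv c \<mu> ^^ i) z m))\<^sup>2)
        \<le> (1 / \<phi> ^ (2 * i) + C / (real N)\<^sup>2) * (\<Sum>m<N. (cmod (z m))\<^sup>2))"
proof -
  obtain \<omega> where \<omega>: "cmod \<omega> = 1" "\<mu> = of_real (cmod \<mu>) * \<omega>"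
    by (rule complex_polar_obtain)
  define P where "P i K \<longleftrightarrow> K \<ge> 0 \<and> (\<forall>N\<ge>1. \<forall>z. (\<forall>m. m < 2 * i \<longrightarrow> z m = 0) \<longrightarrow>
    (\<forall>m\<ge>N-1. z m = 0) \<longrightarrow> (\<Sum>m<N. (cmod ((coarse_inv c \<mu> ^^ i) z m))\<^sup>2)
     \<le> (1 / \<phi> ^ (2 * i)) * (\<Sum>m<N. (cmod (z m))\<^sup>2) + K * (\<Sum>m<N. (cmod (z (Suc m) - \<omega> * z m))\<^sup>2))"
    for i K
  have "\<forall>i. \<exists>K. P i K"
    unfolding P_def using coarse_inv_pow_norm_le[OF assms \<omega>] by blast
  then obtain K where PK: "\<And>i. P i (K i)" by (auto dest: choice)
  have K: "K i \<ge> 0" for i using PK[of i] by (simp add: P_def)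
  have bound: "(\<Sum>m<N. (cmod ((coarse_inv c \<mu> ^^ i) z m))\<^sup>2)
     \<le> (1 / \<phi> ^ (2 * i)) * (\<Sum>m<N. (cmod (z m))\<^sup>2) + K i * (\<Sum>m<N. (cmod (z (Suc m) - \<omega> * z m))\<^sup>2)"
    if "N \<ge> 1" "\<And>m. m < 2 * i \<Longrightarrow> z m = 0" "\<And>m. m \<ge> N-1 \<Longrightarrow> z m = 0" for i N z
    using PK[of i] that by (simp add: P_def)
  define K' where "K' = (\<Sum>i\<le>j. K i)"
  have K': "K' \<ge> 0" "\<And>i. i \<le> j \<Longrightarrow> K i \<le> K'"
    using K by (auto simp: K'_def intro!: sum_nonneg member_le_sum)
  show ?thesis
  proof (intro exI[of _ "K' * 4096"] conjI allI impI)
    show "K' * 4096 \<ge> 0" using K' by simp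
    fix N :: nat assume N: "8 * (2 * j + 4) \<le> N"
    then have "\<exists>h :: nat \<Rightarrow> real. (\<forall>m<2*j+2. h m = 0) \<and> (\<forall>m\<ge>N-1. h m = 0) \<and> (\<Sum>m<N. (h m)\<^sup>2) > 0
      \<and> (\<Sum>m<N. (h (Suc m) - h m)\<^sup>2) \<le> 4096 / (real N)\<^sup>2 * (\<Sum>m<N. (h m)\<^sup>2)"
      by (intro hat_function) simp
    then obtain h :: "nat \<Rightarrow> real" where h: "\<And>m. m < 2 * j + 2 \<Longrightarrow> h m = 0" "\<And>m. m \<ge> N-1 \<Longrightarrow> h m = 0"
      "(\<Sum>m<N. (h m)\<^sup>2) > 0"
      "(\<Sum>m<N. (h (Suc m) - h m)\<^sup>2) \<le> 4096 / (real N)\<^sup>2 * (\<Sum>m<N. (h m)\<^sup>2)"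
      by blast
    \<comment> \<open>The phase \<open>\<omega> ^ m\<close> turns twisted differences of z into
      ordinary differences of the real hat.\<close>
    define z where "z m = \<omega> ^ m * of_real (h m)" for m
    have nz: "(cmod (z m))\<^sup>2 = (h m)\<^sup>2" for m
      by (simp add: z_def norm_mult norm_power \<omega>)
    have nd: "(cmod (z (Suc m) - \<omega> * z m))\<^sup>2 = (h (Suc m) - h m)\<^sup>2" for m
    proof -
      have "z (Suc m) - \<omega> * z m = \<omega> ^ Suc m * of_real (h (Suc m) - h m)"
        by (simp add: z_def algebra_simps)
      then show ?thesis by (simp only: norm_mult norm_power \<omega> norm_of_real) simp
    qed
    have "(\<Sum>m<N. (cmod ((coarse_inv c \<mu> ^^ i) z m))\<^sup>2)
        \<le> (1 / \<phi> ^ (2 * i) + K' * 4096 / (real N)\<^sup>2) * (\<Sum>m<N. (cmod (z m))\<^sup>2)" if "i \<le> j" for i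
    proof -
      have "(\<Sum>m<N. (cmod ((coarse_inv c \<mu> ^^ i) z m))\<^sup>2)
       \<le> (1 / \<phi> ^ (2 * i)) * (\<Sum>m<N. (h m)\<^sup>2) + K i * (\<Sum>m<N. (h (Suc m) - h m)\<^sup>2)"
        using bound[of N i z] h that N by (simp add: nz nd) (simp add: z_def)
      also have "\<dots> \<le> (1 / \<phi> ^ (2 * i)) * (\<Sum>m<N. (h m)\<^sup>2) + K' * (4096 / (real N)\<^sup>2 * (\<Sum>m<N. (h m)\<^sup>2))"
        using K' that h(4) by (intro add_left_mono mult_mono) (auto intro: sum_nonneg)
      finally show ?thesis by (simp add: nz algebra_simps)
    qed
    moreover have "z m = 0" if "h m = 0" for m using that by (simp add: z_def)
    moreover have "0 < (\<Sum>m<N. (cmod (z m))\<^sup>2)" using h(3) by (simp add: nz)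
    ultimately show "\<exists>z. (\<forall>m<2 * j + 2. z m = 0) \<and> (\<forall>m\<ge>N - 1. z m = 0) \<and> 0 < (\<Sum>m<N. (cmod (z m))\<^sup>2) \<and>
        (\<forall>i\<le>j. (\<Sum>m<N. (cmod ((coarse_inv c \<mu> ^^ i) z m))\<^sup>2)
         \<le> (1 / \<phi> ^ (2 * i) + K' * 4096 / (real N)\<^sup>2) * (\<Sum>m<N. (cmod (z m))\<^sup>2))"
      using h(1,2) by (intro exI[of _ z]) blast
  qed
qed

section \<open>The blocks of the error propagator\<close>

lemma matrix_add_rdistrib: "(A + B) ** C = A ** C + B ** (C :: 'a::semiring_1 ^ 'p ^ 'n)"
  by (simp add: matrix_matrix_mult_def vec_eq_iff sum.distrib distrib_right)

lemma matrix_diff_ldistrib: "A ** (B - C) = A ** B - A ** (C :: 'a::ring_1 ^ 'p ^ 'n)"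
  by (simp add: matrix_matrix_mult_def vec_eq_iff sum_subtractf right_diff_distrib)

lemma bmult_assoc: "finite S \<Longrightarrow> bmult S (bmult S M P) Q = bmult S M (bmult S P Q)"
proof (intro ext)
  fix i j
  have l: "(\<Sum>s\<in>S. f s) ** B = (\<Sum>s\<in>S. f s ** B)" for f :: "nat \<Rightarrow> complex ^ 'n ^ 'n" and B
    by (induction S rule: infinite_finite_induct) (simp_all add: matrix_add_rdistrib)
  have r: "B ** (\<Sum>s\<in>S. f s) = (\<Sum>s\<in>S. B ** f s)" for f :: "nat \<Rightarrow> complex ^ 'n ^ 'n" and B
    by (induction S rule: infinite_finite_induct) (simp_all add: matrix_add_ldistrib)
  show "bmult S (bmult S M P) Q i j = bmult S M (bmult S P Q) i j"
    unfolding bmult_def l r matrix_mul_assoc by (rule sum.swap)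
qed

lemma sum_if_eq_if_eq:
  assumes "finite S" "a \<noteq> b"
  shows "(\<Sum>s\<in>S. if s = a then f s else if s = b then g s else 0)
    = (if a \<in> S then f a else 0) + (if b \<in> S then (g b :: 'b :: comm_monoid_add) else 0)"
proof -
  have "(\<Sum>s\<in>S. if s = a then f s else if s = b then g s else 0)
    = (\<Sum>s\<in>S. (if s = a then f s else 0) + (if s = b then g s else 0))"
    by (rule sum.cong) (use assms in auto)
  then show ?thesis using assms by (simp add: sum.distrib)
qed

text \<open>Uniqueness is the usual Y = Y (M X) = (Y M) X on S; outside S it comes from the
  convention that an inverse vanishes there, without which the \<open>THE\<close> would have no
  unique witness.\<close>

lemma binverse_eqI:
  assumes "finite S"
    and "\<And>i j. i \<in> S \<Longrightarrow> j \<in> S \<Longrightarrow> bmult S M X i j = bident i j"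
    and "\<And>i j. i \<in> S \<Longrightarrow> j \<in> S \<Longrightarrow> bmult S X M i j = bident i j"
    and "\<And>i j. i \<notin> S \<or> j \<notin> S \<Longrightarrow> X i j = 0"
  shows "binverse S M = X"
  unfolding binverse_def
proof (rule the_equality)
  fix Y :: "'a bmat" assume Y: "(\<forall>i\<in>S. \<forall>j\<in>S. bmult S M Y i j = bident i j \<and> bmult S Y M i j = bident i j) \<and>
     (\<forall>i j. i \<notin> S \<or> j \<notin> S \<longrightarrow> Y i j = 0)"
  show "Y = X"
  proof (intro ext)
    fix i j
    show "Y i j = X i j"
    proof (cases "i \<in> S \<and> j \<in> S")
      case True
      have "bmult S Y (bmult S M X) i j = (\<Sum>s\<in>S. if s = j then Y i s else 0)"
        unfolding bmult_def[of S Y] using True assms(2)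
        by (intro sum.cong) (auto simp: bident_def)
      then have "bmult S Y (bmult S M X) i j = Y i j" using True assms(1) by simp
      moreover have "bmult S (bmult S Y M) X i j = (\<Sum>s\<in>S. if s = i then X s j else 0)"
        unfolding bmult_def[of S _ X] using True Y
        by (intro sum.cong) (auto simp: bident_def)
      then have "bmult S (bmult S Y M) X i j = X i j" using True assms(1) by simp
      ultimately show ?thesis using bmult_assoc[OF assms(1)] by metis
    qed (use Y assms in auto)
  qed
qed (use assms in auto)

lemma mpow_0 [simp]: "mpow M 0 = mat 1"
  by (simp add: mpow_def)

lemma mpow_Suc: "mpow M (Suc q) = M ** mpow M q"
  by (simp add: mpow_def)

lemma mpow_Suc': "mpow M (Suc q) = mpow M q ** M"
  by (induction q) (simp_all add: mpow_Suc matrix_mul_assoc)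

lemma matrix_mult_uminus_left: "(- A) ** B = - (A ** (B :: 'a::ring_1 ^ 'p ^ 'n))"
  by (simp add: matrix_matrix_mult_def vec_eq_iff sum_negf)

lemma matrix_mult_uminus_right: "A ** (- B) = - (A ** (B :: 'a::ring_1 ^ 'p ^ 'n))"
  by (simp add: matrix_matrix_mult_def vec_eq_iff sum_negf)

text \<open>The row i need not belong to S, so the same formula covers the block A_ff and the
  coupling block A_cf.\<close>

lemma bmult_bidiag_left:
  assumes "finite S"
  shows "bmult S (bidiag T) X i j
    = (if i \<in> S then X i j else 0) - (if i > 0 \<and> i - 1 \<in> S then T ** X (i - 1) j else 0)"
proof (cases i)
  case 0
  have "bmult S (bidiag T) X i j = (\<Sum>s\<in>S. if s = i then X s j else 0)"
    unfolding bmult_def by (rule sum.cong) (auto simp: bidiag_def 0)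
  then show ?thesis using assms 0 by simp
next
  case (Suc i')
  have "bmult S (bidiag T) X i j
    = (\<Sum>s\<in>S. if s = i then X s j else if s = i' then - (T ** X s j) else 0)"
    unfolding bmult_def by (rule sum.cong) (auto simp: bidiag_def Suc matrix_mult_uminus_left)
  also have "\<dots> = (if i \<in> S then X i j else 0) + (if i' \<in> S then - (T ** X i' j) else 0)"
    using assms Suc by (intro sum_if_eq_if_eq) auto
  finally show ?thesis by (simp add: Suc)
qed

lemma bmult_bidiag_right:
  assumes "finite S"
  shows "bmult S X (bidiag T) i j
    = (if j \<in> S then X i j else 0) - (if Suc j \<in> S then X i (Suc j) ** T else 0)"
proof -
  have "bmult S X (bidiag T) i j
    = (\<Sum>s\<in>S. if s = j then X i s else if s = Suc j then - (X i s ** T) else 0)"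
    unfolding bmult_def by (rule sum.cong) (auto simp: bidiag_def matrix_mult_uminus_right)
  also have "\<dots> = (if j \<in> S then X i j else 0) + (if Suc j \<in> S then - (X i (Suc j) ** T) else 0)"
    using assms by (intro sum_if_eq_if_eq) auto
  finally show ?thesis by simp
qed

section \<open>Entries of the inverses and of the error propagator\<close>

lemma finite_fpts [simp]: "finite (fpts k Nc)"
  unfolding fpts_def by simp

lemma finite_cpts [simp]: "finite (cpts k Nc)"
  unfolding cpts_def by simp

lemma div_mod_pred:
  fixes i k :: nat
  assumes "i mod k \<noteq> 0"
  shows "(i - 1) div k = i div k" "(i - 1) mod k = i mod k - 1"
proof -
  obtain i' where i: "i = Suc i'" using assms by (cases i) auto
  show "(i - 1) div k = i div k" "(i - 1) mod k = i mod k - 1"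
    using assms unfolding i by (auto simp: div_Suc mod_Suc split: if_splits)
qed

text \<open>A_ff decouples into one bidiagonal block for each interval between C-points, recognized
  by a common value of \<open>div k\<close>; inside an interval the inverse is the propagation by
  powers of \<open>\<Phi>\<close>.\<close>

lemma binverse_fpts:
  assumes "k \<ge> 2"
  shows "binverse (fpts k Nc) (bidiag \<Phi>)
    = (\<lambda>i j. if i \<in> fpts k Nc \<and> j \<in> fpts k Nc \<and> j \<le> i \<and> i div k = j div k
        then mpow \<Phi> (i - j) else 0)" (is "_ = ?X")
proof (rule binverse_eqI)
  fix i j assume i: "i \<in> fpts k Nc" and j: "j \<in> fpts k Nc"
  have im: "i mod k \<noteq> 0" "j mod k \<noteq> 0" using i j by (auto simp: fpts_def mod_eq_0_iff_dvd)
  have i0: "i > 0" using im by (cases i) auto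
  \<comment> \<open>The next facts locate i and j inside their intervals: a predecessor is an
    F-point unless i comes first, and a successor that is an F-point stays in the interval.\<close>
  have A: "i - 1 \<in> fpts k Nc \<longleftrightarrow> i mod k \<noteq> 1"
    using i im i0 div_mod_pred(2)[OF im(1)] by (auto simp: fpts_def mod_eq_0_iff_dvd[symmetric])
  have B: "Suc j \<in> fpts k Nc" if "j < i" "i div k = j div k"
  proof -
    have "j mod k < i mod k"
      using that by (metis add_less_cancel_left div_mult_mod_eq)
    then have "j mod k + 1 < k" using mod_less_divisor[of k i] assms by linarith
    then have "Suc j mod k = Suc (j mod k)" by (simp add: mod_Suc)
    then show ?thesis using i that by (auto simp: fpts_def mod_eq_0_iff_dvd[symmetric])
  qed
  have C: "Suc j div k = j div k" if "Suc j \<in> fpts k Nc"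
    using that by (auto simp: fpts_def div_Suc mod_eq_0_iff_dvd[symmetric])
  have D: "i mod k \<noteq> 1" if "j < i" "i div k = j div k"
  proof -
    have "j mod k < i mod k"
      using that by (metis add_less_cancel_left div_mult_mod_eq)
    then show ?thesis using im by simp
  qed
  show "bmult (fpts k Nc) (bidiag \<Phi>) ?X i j = bident i j"
  proof (cases "j < i \<and> i div k = j div k")
    case True
    then have "i - j = Suc (i - 1 - j)" by (simp add: Suc_diff_Suc)
    then have "mpow \<Phi> (i - j) = \<Phi> ** mpow \<Phi> (i - 1 - j)" by (simp only: mpow_Suc)
    then show ?thesis
      using True i j i0 A D div_mod_pred(1)[OF im(1)]
      by (auto simp: bmult_bidiag_left bident_def)
  next
    case False
    then show ?thesis
      using i j i0 A div_mod_pred(1)[OF im(1)]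
      by (auto simp: bmult_bidiag_left bident_def)
  qed
  show "bmult (fpts k Nc) ?X (bidiag \<Phi>) i j = bident i j"
  proof (cases "j < i \<and> i div k = j div k")
    case True
    then have "i - j = Suc (i - Suc j)" by (simp add: Suc_diff_Suc)
    then have "mpow \<Phi> (i - j) = mpow \<Phi> (i - Suc j) ** \<Phi>" by (simp only: mpow_Suc')
    then show ?thesis
      using True i j B C by (auto simp: bmult_bidiag_right bident_def)
  next
    case False
    then show ?thesis
      using i j C by (auto simp: bmult_bidiag_right bident_def)
  qed
qed auto

lemma fpts_minus_mod:
  "i \<in> fpts k Nc \<Longrightarrow> Suc (i div k * k) \<in> fpts k Nc" if "k \<ge> 2"
proof -
  assume i: "i \<in> fpts k Nc"
  then have "i mod k > 0" by (auto simp: fpts_def dvd_eq_mod_eq_0)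
  moreover have "i = i div k * k + i mod k" by simp
  ultimately have "Suc (i div k * k) \<le> i" by linarith
  moreover have "\<not> k dvd Suc (i div k * k)"
    using that by (auto simp: dvd_eq_mod_eq_0 mod_Suc)
  ultimately show ?thesis using i by (auto simp: fpts_def)
qed

text \<open>A C-point feeds only the F-point right after it, through one factor -\<Phi>; the inverse
  on the interval carries this value on to i.\<close>

lemma extension_eq:
  assumes "k \<ge> 2" "i \<in> fpts k Nc" "j \<in> cpts k Nc"
  shows "extension k Nc \<Phi> i j = (if j = i div k * k then - mpow \<Phi> (i mod k) else 0)"
proof -
  have j: "j \<notin> fpts k Nc" "j = j div k * k" using assms by (auto simp: fpts_def cpts_def)
  have im: "i mod k \<noteq> 0" using assms by (auto simp: fpts_def mod_eq_0_iff_dvd)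
  have Sj: "Suc j div k = j div k"
    using assms(1,3) by (auto simp: cpts_def div_Suc mod_Suc)
  show ?thesis
  proof (cases "j = i div k * k")
    case True
    then have "Suc j \<in> fpts k Nc" using fpts_minus_mod[OF assms(1,2)] by simp
    moreover have ij: "i = j + i mod k" using True by simp
    moreover have "j div k = i div k" using True assms(1) by simp
    moreover have "Suc j \<le> i" using ij im by linarith
    moreover have "i mod k = Suc (i - Suc j)" using ij im by linarith
    then have "mpow \<Phi> (i mod k) = mpow \<Phi> (i - Suc j) ** \<Phi>" by (simp only: mpow_Suc')
    ultimately show ?thesis
      using assms j Sj True im
      by (auto simp: extension_def binverse_fpts bmult_bidiag_right)
  next
    case False
    then show ?thesis
      using j Sj assms(1) by (auto simp: extension_def binverse_fpts bmult_bidiag_right)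
  qed
qed

text \<open>A C-point receives only from the last F-point of the preceding interval, whose residue
  is k-1. The last fine step completes the k-th power and the two minus signs cancel.\<close>

lemma schur_correction_eq:
  assumes "k \<ge> 2" "i \<in> cpts k Nc" "j \<in> cpts k Nc"
  shows "schur_correction k Nc \<Phi> i j = (if i = j + k then mpow \<Phi> k else 0)"
proof (cases "i = 0")
  case True
  then show ?thesis using assms by (auto simp: schur_correction_def bmult_bidiag_left fpts_def)
next
  case False
  have i: "i \<notin> fpts k Nc" "i = i div k * k" using assms by (auto simp: fpts_def cpts_def)
  have j: "j = j div k * k" using assms by (auto simp: cpts_def)
  define q where "q = i div k - 1"
  have "i div k > 0" using i False by (metis gr0I mult_0)
  then have q: "i = q * k + k" using i(2) by (metis Suc_pred' add.commute mult_Suc q_def)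
  have i1: "i - 1 = q * k + (k - 1)" using q assms(1) by simp
  have dm: "(i - 1) div k = q" "(i - 1) mod k = k - 1"
    unfolding i1 using assms(1) by (auto simp del: add_diff_assoc)
  have F: "i - 1 \<in> fpts k Nc"
    using dm(2) assms by (auto simp: fpts_def cpts_def dvd_eq_mod_eq_0)
  have "mpow \<Phi> k = \<Phi> ** mpow \<Phi> (k - 1)"
    using assms(1) by (metis Suc_diff_1 mpow_Suc less_le_trans pos2)
  then show ?thesis
    using False F i extension_eq[OF assms(1) F assms(3), of \<Phi>] dm q
    by (auto simp: schur_correction_def bmult_bidiag_left matrix_mult_uminus_right)
qed

lemma cpts_iff:
  assumes "k \<ge> 1" "Nc \<ge> 1"
  shows "i \<in> cpts k Nc \<longleftrightarrow> (\<exists>m<Nc. i = m * k)"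
proof -
  have "m * k < num_points k Nc \<longleftrightarrow> m < Nc" for m
  proof -
    have "m * k < num_points k Nc \<longleftrightarrow> m * k \<le> (Nc - 1) * k" by (simp add: num_points_def less_Suc_eq_le)
    also have "\<dots> \<longleftrightarrow> m \<le> Nc - 1" using assms by (subst mult_le_cancel2) auto
    finally show ?thesis using assms by linarith
  qed
  then show ?thesis by (auto simp: cpts_def dvd_def mult.commute)
qed

lemma bmult_B_Delta_right:
  assumes "k \<ge> 1" "j \<in> cpts k Nc"
  shows "bmult (cpts k Nc) X (B_Delta k \<Psi>) i j
    = X i j - (if j + k \<in> cpts k Nc then X i (j + k) ** \<Psi> else 0)"
proof -
  have "bmult (cpts k Nc) X (B_Delta k \<Psi>) i j
    = (\<Sum>s\<in>cpts k Nc. if s = j then X i s else if s = j + k then - (X i s ** \<Psi>) else 0)"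
    unfolding bmult_def
  proof (rule sum.cong)
    fix s assume "s \<in> cpts k Nc"
    then obtain a b where "s = k * a" "j = k * b" using assms by (auto simp: cpts_def elim!: dvdE)
    then show "X i s ** B_Delta k \<Psi> s j = (if s = j then X i s else if s = j + k then - (X i s ** \<Psi>) else 0)"
    proof -
      have "k * b + k = k * Suc b" by simp
      then have "s = j + k \<longleftrightarrow> a = Suc b" "s = j \<longleftrightarrow> a = b"
        using \<open>s = k * a\<close> \<open>j = k * b\<close> assms(1) by (auto simp del: mult_Suc_right)
      then show ?thesis
        using assms(1) \<open>s = k * a\<close> \<open>j = k * b\<close>
        by (simp add: B_Delta_def bidiag_def matrix_mult_uminus_right)
    qed
  qed simp
  also have "\<dots> = (if j \<in> cpts k Nc then X i j else 0) + (if j + k \<in> cpts k Nc then - (X i (j + k) ** \<Psi>) else 0)"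
    using assms by (intro sum_if_eq_if_eq) auto
  finally show ?thesis using assms by simp
qed

lemma bmult_B_Delta_left:
  assumes "k \<ge> 2" "i \<in> cpts k Nc"
  shows "bmult (cpts k Nc) (B_Delta k \<Psi>) X i j
    = X i j - (if i \<ge> k then \<Psi> ** X (i - k) j else 0)"
proof -
  have mem: "i - k \<in> cpts k Nc" if "i \<ge> k" using that assms by (auto simp: cpts_def)
  \<comment> \<open>The first C-point has no coarse predecessor. \<open>Suc i\<close> stands in for
    it below: distinct from i and, as k \<ge> 2, not a C-point, so its term drops out.\<close>
  have no: "Suc i \<notin> cpts k Nc" if "\<not> k \<le> i"
  proof -
    have "i mod k = 0" using assms by (simp add: cpts_def)
    then have "i = 0" using that by simp
    then show ?thesis using assms(1) by (simp add: cpts_def)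
  qed
  have "bmult (cpts k Nc) (B_Delta k \<Psi>) X i j
    = (\<Sum>s\<in>cpts k Nc. if s = i then X s j else if s = (if k \<le> i then i - k else Suc i) then - (\<Psi> ** X s j) else 0)"
    unfolding bmult_def
  proof (rule sum.cong)
    fix s assume s: "s \<in> cpts k Nc"
    then obtain a b where ab: "s = k * a" "i = k * b" using assms by (auto simp: cpts_def elim!: dvdE)
    show "B_Delta k \<Psi> i s ** X s j = (if s = i then X s j else
      if s = (if k \<le> i then i - k else Suc i) then - (\<Psi> ** X s j) else 0)"
    proof -
      have "k * a + k = k * Suc a" by simp
      then have "i = s + k \<longleftrightarrow> b = Suc a" "s = i \<longleftrightarrow> a = b"
        using ab assms(1) by (auto simp del: mult_Suc_right)
      moreover have "i = s + k \<longleftrightarrow> s = (if k \<le> i then i - k else Suc i)"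
        using assms(1) by (cases b) (auto simp: ab)
      ultimately show ?thesis
        using assms(1) ab by (simp add: B_Delta_def bidiag_def matrix_mult_uminus_left)
    qed
  qed simp
  also have "\<dots> = (if i \<in> cpts k Nc then X i j else 0)
    + (if (if k \<le> i then i - k else Suc i) \<in> cpts k Nc
       then - (\<Psi> ** X (if k \<le> i then i - k else Suc i) j) else 0)"
    using assms by (intro sum_if_eq_if_eq) auto
  finally show ?thesis using assms mem no by auto
qed

lemma cpts_add:
  assumes "k \<ge> 1" "i \<in> cpts k Nc" "j \<in> cpts k Nc" "j < i"
  shows "j + k \<in> cpts k Nc" "j + k \<le> i" "i div k = Suc ((i - (j + k)) div k + j div k)"
    "(i - j) div k = Suc ((i - (j + k)) div k)"
proof -
  obtain a b where ab: "i = k * a" "j = k * b" using assms(2,3) unfolding cpts_def dvd_def by blast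
  then have "Suc b \<le> a" using assms by auto
  then obtain c where c: "a = c + Suc b" by (metis le_iff_add add.commute)
  have i: "i = j + k + k * c" by (simp add: ab c algebra_simps)
  then show "j + k \<le> i" by simp
  show "j + k \<in> cpts k Nc" using assms i by (auto simp: cpts_def)
  show "i div k = Suc ((i - (j + k)) div k + j div k)"
    unfolding i using assms(1) by (simp add: ab(2) add.commute)
  show "(i - j) div k = Suc ((i - (j + k)) div k)"
    unfolding i using assms(1) by simp
qed

text \<open>The inverse is the finite Neumann series of the nilpotent coarse subdiagonal; the coarse
  distance of two C-points is their fine distance divided by k.\<close>

lemma binverse_B_Delta:
  assumes "k \<ge> 2"
  shows "binverse (cpts k Nc) (B_Delta k \<Psi>)
    = (\<lambda>i j. if i \<in> cpts k Nc \<and> j \<in> cpts k Nc \<and> j \<le> i then mpow \<Psi> ((i - j) div k) else 0)"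
    (is "_ = ?X")
proof (rule binverse_eqI)
  fix i j assume i: "i \<in> cpts k Nc" and j: "j \<in> cpts k Nc"
  have k: "k \<ge> 1" using assms by simp
  have mem: "i - k \<in> cpts k Nc" if "i \<ge> k" using that i by (auto simp: cpts_def)
  show "bmult (cpts k Nc) (B_Delta k \<Psi>) ?X i j = bident i j"
  proof (cases "j < i")
    case True
    note c = cpts_add[OF k i j True]
    have "i - k - j = i - (j + k)" by simp
    then show ?thesis
      using True i j c mem by (auto simp: bmult_B_Delta_left[OF assms i] bident_def mpow_Suc)
  next
    case False
    then show ?thesis
      using i j assms by (auto simp: bmult_B_Delta_left[OF assms i] bident_def)
  qed
  show "bmult (cpts k Nc) ?X (B_Delta k \<Psi>) i j = bident i j"
  proof (cases "j < i")
    case True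
    note c = cpts_add[OF k i j True]
    then show ?thesis
      using True i j c by (auto simp: bmult_B_Delta_right[OF k j] bident_def mpow_Suc')
  next
    case False
    then show ?thesis
      using i j assms by (auto simp: bmult_B_Delta_right[OF k j] bident_def)
  qed
qed auto

lemma bmult_cong_right:
  "(\<And>s. s \<in> S \<Longrightarrow> P s j = Q s j) \<Longrightarrow> bmult S M P i j = bmult S M Q i j"
  unfolding bmult_def by (rule sum.cong) auto

text \<open>Eliminating the F-points leaves time stepping with the exact coarse propagator \<Phi>^k,
  so the method would be exact on the coarse grid for \<Psi> = \<Phi>^k.\<close>

lemma A_Delta_eq:
  assumes "k \<ge> 2" "i \<in> cpts k Nc" "j \<in> cpts k Nc"
  shows "A_Delta k Nc \<Phi> i j = B_Delta k (mpow \<Phi> k) i j"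
proof -
  obtain a b where ab: "i = k * a" "j = k * b" using assms by (auto simp: cpts_def elim!: dvdE)
  have "k * b + k = k * Suc b" by simp
  then have e: "i = j + k \<longleftrightarrow> a = Suc b" "i = j \<longleftrightarrow> a = b"
    using ab assms(1) by (auto simp del: mult_Suc_right)
  \<comment> \<open>Since k \<ge> 2, C-points are never adjacent; hence the fine subdiagonal
    contributes nothing to A_cc.\<close>
  have "i \<noteq> Suc j"
  proof
    assume "i = Suc j"
    then have "i mod k = Suc j mod k" by simp
    then show False using assms(1) by (simp add: ab mod_Suc split: if_splits)
  qed
  then show ?thesis
    using assms(1) schur_correction_eq[OF assms, of \<Phi>] ab e
    by (auto simp: A_Delta_def B_Delta_def bidiag_def)
qed

text \<open>At coarse distance d \<ge> 1 the product contributes \<Psi>^d - \<Psi>^(d-1) \<Phi>^k,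
  from which \<Psi>^(d-1) is factored out; the diagonal cancels against the identity.\<close>

lemma coarse_correction_eq:
  assumes "k \<ge> 2" "i \<in> cpts k Nc" "j \<in> cpts k Nc"
  shows "(bident - bmult (cpts k Nc) (binverse (cpts k Nc) (B_Delta k \<Psi>)) (A_Delta k Nc \<Phi>)) i j
    = (if j < i then mpow \<Psi> (i div k - j div k - 1) ** (mpow \<Phi> k - \<Psi>) else 0)"
proof -
  let ?B = "binverse (cpts k Nc) (B_Delta k \<Psi>)"
  have k: "k \<ge> 1" using assms by simp
  have "bmult (cpts k Nc) ?B (A_Delta k Nc \<Phi>) i j = bmult (cpts k Nc) ?B (B_Delta k (mpow \<Phi> k)) i j"
    using assms by (intro bmult_cong_right A_Delta_eq)
  also have "\<dots> = ?B i j - (if j + k \<in> cpts k Nc then ?B i (j + k) ** mpow \<Phi> k else 0)"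
    by (rule bmult_B_Delta_right[OF k assms(3)])
  finally have e: "bmult (cpts k Nc) ?B (A_Delta k Nc \<Phi>) i j = \<dots>" .
  show ?thesis
  proof (cases "j < i")
    case True
    note c = cpts_add[OF k assms(2,3) True]
    have d': "i div k - j div k - 1 = (i - (j + k)) div k" using c(3) by simp
    show ?thesis
      using True assms c
      by (simp only: minus_apply e d')
         (simp add: binverse_B_Delta bident_def c(4) mpow_Suc' matrix_diff_ldistrib)
  next
    case False
    then show ?thesis
      using assms by (simp only: minus_apply e) (auto simp: binverse_B_Delta bident_def)
  qed
qed

text \<open>The correction and the extra coarse relaxation each delay by one coarse step. This is
  the origin of the delay of two in \<open>coarse_op\<close>.\<close>

lemma right_factor_eq:
  assumes "k \<ge> 2" "i \<in> cpts k Nc" "j \<in> cpts k Nc"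
  shows "right_factor k Nc \<Phi> \<Psi> i j
    = (if j + k < i then mpow \<Psi> (i div k - j div k - 2) ** (mpow \<Phi> k - \<Psi>) ** mpow \<Phi> k else 0)"
proof -
  let ?W = "bident - bmult (cpts k Nc) (binverse (cpts k Nc) (B_Delta k \<Psi>)) (A_Delta k Nc \<Phi>)"
  have "right_factor k Nc \<Phi> \<Psi> i j = bmult (cpts k Nc) ?W (schur_correction k Nc \<Phi>) i j"
    using assms by (auto simp: right_factor_def fpts_def cpts_def)
  also have "\<dots> = (\<Sum>s\<in>cpts k Nc. if s = j + k then ?W i s ** mpow \<Phi> k else 0)"
    unfolding bmult_def[of _ ?W]
    by (rule sum.cong) (use assms in \<open>auto simp: schur_correction_eq\<close>)
  also have "\<dots> = (if j + k \<in> cpts k Nc then ?W i (j + k) ** mpow \<Phi> k else 0)"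
    by simp
  finally have e: "right_factor k Nc \<Phi> \<Psi> i j = \<dots>" .
  show ?thesis
  proof (cases "j + k \<in> cpts k Nc")
    case True
    have "(j + k) div k = Suc (j div k)" using assms(1) by simp
    then show ?thesis
      using True unfolding e coarse_correction_eq[OF assms(1,2) True] by (simp add: matrix_mul_assoc)
  next
    case False
    then have "\<not> j + k < i"
      using assms by (auto simp: cpts_def)
    then show ?thesis using False by (simp add: e)
  qed
qed

lemma left_factor_eq:
  assumes "k \<ge> 2" "i < num_points k Nc" "j \<in> cpts k Nc"
  shows "left_factor k Nc \<Phi> i j = (if j = i div k * k then mpow \<Phi> (i mod k) else 0)"
proof (cases "i \<in> fpts k Nc")
  case True
  then show ?thesis using assms by (simp add: left_factor_def extension_eq)
next
  case False
  then have "i mod k = 0" using assms by (simp add: fpts_def mod_eq_0_iff_dvd)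
  moreover from this have "i = i div k * k" by (metis add_0_right div_mult_mod_eq)
  ultimately show ?thesis using False by (auto simp: left_factor_def bident_def)
qed

lemma E_FCF_eq:
  assumes "k \<ge> 2" "i < num_points k Nc" "j \<in> cpts k Nc"
  shows "E_FCF k Nc \<Phi> \<Psi> i j
    = (if j div k + 1 < i div k then mpow \<Phi> (i mod k) **
        (mpow \<Psi> (i div k - j div k - 2) ** (mpow \<Phi> k - \<Psi>) ** mpow \<Phi> k) else 0)"
proof -
  have m: "i div k * k \<in> cpts k Nc"
    using assms by (auto simp: cpts_def intro: le_less_trans[OF div_times_less_eq_dividend])
  have "E_FCF k Nc \<Phi> \<Psi> i j
    = (\<Sum>s\<in>cpts k Nc. if s = i div k * k then mpow \<Phi> (i mod k) ** right_factor k Nc \<Phi> \<Psi> s j else 0)"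
    unfolding E_FCF_def bmult_def
    by (rule sum.cong) (use assms in \<open>auto simp: left_factor_eq\<close>)
  also have "\<dots> = mpow \<Phi> (i mod k) ** right_factor k Nc \<Phi> \<Psi> (i div k * k) j"
    using m by simp
  also have "j + k < i div k * k \<longleftrightarrow> j div k + 1 < i div k"
  proof -
    obtain b where b: "j = b * k" using assms by (auto simp: cpts_def mult.commute elim!: dvdE)
    have "j + k < i div k * k \<longleftrightarrow> Suc b * k < i div k * k" by (simp add: b add.commute)
    also have "\<dots> \<longleftrightarrow> Suc b < i div k" using assms(1) by (subst mult_less_cancel2) auto
    finally show ?thesis using b assms(1) by simp
  qed
  then have "right_factor k Nc \<Phi> \<Psi> (i div k * k) j
    = (if j div k + 1 < i div k then mpow \<Psi> (i div k - j div k - 2) ** (mpow \<Phi> k - \<Psi>) ** mpow \<Phi> k else 0)"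
    using assms(1) by (simp add: right_factor_eq[OF assms(1) m assms(3)])
  finally show ?thesis by simp
qed

lemma E_FCF_eq_0:
  assumes "j \<in> fpts k Nc"
  shows "E_FCF k Nc \<Phi> \<Psi> i j = 0"
  using assms by (simp add: E_FCF_def bmult_def right_factor_def)

section \<open>Coordinates in the eigenvector basis\<close>

lemma L2_set_sq: "(L2_set f A)\<^sup>2 = (\<Sum>i\<in>A. (f i)\<^sup>2)"
  by (simp add: L2_set_def sum_nonneg)

lemma norm_vec_sq: "(norm (x :: complex ^ 'n))\<^sup>2 = (\<Sum>l\<in>UNIV. (cmod (x $ l))\<^sup>2)"
  by (simp add: norm_vec_def L2_set_sq)

lemma matrix_inv_mult:
  fixes U :: "complex ^ 'n ^ 'n"
  assumes "invertible U"
  shows "matrix_inv U ** U = mat 1" "U ** matrix_inv U = mat 1"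
  using someI_ex[of "\<lambda>B. U ** B = mat 1 \<and> B ** U = mat 1"] assms
  unfolding matrix_inv_def invertible_def by blast+

definition coord :: "complex ^ 'n ^ 'n \<Rightarrow> 'n::finite \<Rightarrow> complex ^ 'n \<Rightarrow> complex" where
  "coord U l x = (matrix_inv U *v x) $ l"

lemma coord_0 [simp]: "coord U l 0 = 0"
  by (simp add: coord_def)

lemma coord_add: "coord U l (x + y) = coord U l x + coord U l y"
  by (simp add: coord_def matrix_vector_right_distrib)

lemma coord_diff: "coord U l (x - y) = coord U l x - coord U l y"
  by (simp add: coord_def matrix_vector_mult_diff_distrib)

lemma coord_sum: "coord U l (\<Sum>s\<in>S. f s) = (\<Sum>s\<in>S. coord U l (f s))"
  by (induction S rule: infinite_finite_induct) (simp_all add: coord_add)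

lemma U_norm_sq:
  "(U_norm k U Nc x)\<^sup>2 = (\<Sum>l\<in>UNIV. \<Sum>j<num_points k Nc. (cmod (coord U l (x j)))\<^sup>2)"
  unfolding U_norm_def l2_norm_def L2_set_sq norm_vec_sq coord_def by (rule sum.swap)

lemma l2_norm_nonneg [simp]: "l2_norm k Nc x \<ge> 0"
  by (simp add: l2_norm_def)

lemma U_norm_nonneg [simp]: "U_norm k U Nc x \<ge> 0"
  by (simp add: U_norm_def)

lemma l2_norm_le:
  assumes "\<And>j. j < num_points k Nc \<Longrightarrow> norm (x j) \<le> K * norm (y j)" "K \<ge> 0"
  shows "l2_norm k Nc x \<le> K * l2_norm k Nc y"
proof -
  have "l2_norm k Nc x \<le> L2_set (\<lambda>j. K * norm (y j)) {..<num_points k Nc}"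
    unfolding l2_norm_def by (rule L2_set_mono) (use assms in auto)
  also have "\<dots> = K * l2_norm k Nc y"
    unfolding l2_norm_def using assms(2) by (simp add: L2_set_right_distrib)
  finally show ?thesis .
qed

text \<open>The constants a and b are independent of \<open>Nc\<close>, so the uniformity of the
  convergence survives the change of norm.\<close>

lemma asymp_convergent_transfer:
  assumes "asymp_convergent k \<Phi> \<Psi> nrm" "a \<ge> 0" "b \<ge> 0"
    and "\<And>Nc x. Nc \<ge> 1 \<Longrightarrow> nrm Nc x \<le> a * nrm' Nc x"
    and "\<And>Nc x. Nc \<ge> 1 \<Longrightarrow> nrm' Nc x \<le> b * nrm Nc x"
    and "\<And>Nc x. nrm' Nc x \<ge> 0"
  shows "asymp_convergent k \<Phi> \<Psi> nrm'"
  unfolding asymp_convergent_def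
proof (intro allI impI)
  fix \<epsilon> :: real assume \<epsilon>: "\<epsilon> > 0"
  \<comment> \<open>Adding 1 keeps the denominator positive when a or b is zero.\<close>
  define \<delta> where "\<delta> = \<epsilon> / ((a + 1) * (b + 1))"
  have ab: "(a + 1) * (b + 1) > 0" using assms by simp
  have "\<delta> > 0" using \<epsilon> ab by (simp add: \<delta>_def)
  then obtain P where P: "\<And>p Nc e0. p \<ge> P \<Longrightarrow> Nc \<ge> 1 \<Longrightarrow>
      nrm Nc (mgrit_error k \<Phi> \<Psi> Nc e0 p) \<le> \<delta> * nrm Nc e0"
    using assms(1) unfolding asymp_convergent_def by blast
  have "nrm' Nc (mgrit_error k \<Phi> \<Psi> Nc e0 p) \<le> \<epsilon> * nrm' Nc e0" if "p \<ge> P" "Nc \<ge> 1" for p Nc e0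
  proof -
    have "nrm' Nc (mgrit_error k \<Phi> \<Psi> Nc e0 p) \<le> b * (\<delta> * (a * nrm' Nc e0))"
      using assms(4)[OF that(2)] \<open>\<delta> > 0\<close> assms(3) P[OF that]
      by (meson assms(5) less_imp_le mult_left_mono order_trans that(2))
    also have "\<dots> = \<epsilon> * ((a * b) / ((a + 1) * (b + 1)) * nrm' Nc e0)"
      by (simp add: \<delta>_def)
    also have "\<dots> \<le> \<epsilon> * (1 * nrm' Nc e0)"
    proof (intro mult_left_mono mult_right_mono)
      show "(a * b) / ((a + 1) * (b + 1)) \<le> 1"
        using ab assms by (subst divide_le_eq_1_pos) (auto simp: algebra_simps)
    qed (use assms \<epsilon> in auto)
    finally show ?thesis by simp
  qed
  then show "\<exists>P. \<forall>p\<ge>P. \<forall>Nc\<ge>1. \<forall>e0. nrm' Nc (mgrit_error k \<Phi> \<Psi> Nc e0 p) \<le> \<epsilon> * nrm' Nc e0"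
    by blast
qed

section \<open>Eigenvalues and diagonalized coordinates\<close>

lemma coord_eigen:
  assumes "diagonalized_by M U d"
  shows "coord U l (M *v x) = d l * coord U l x"
proof -
  define y where "y = matrix_inv U *v x"
  have inv: "invertible U" and ev: "\<And>l. M *v column l U = d l *s column l U"
    using assms by (auto simp: diagonalized_by_def)
  have x: "x = U *v y"
    using matrix_inv_mult[OF inv] by (simp add: y_def matrix_vector_mul_assoc)
  have M: "M *v (\<Sum>l\<in>S. c l *s v l) = (\<Sum>l\<in>S. c l *s (M *v v l))" for S c and v :: "'a \<Rightarrow> complex ^ 'a"
    by (induction S rule: infinite_finite_induct)
       (simp_all add: matrix_vector_right_distrib vector_scalar_commute)
  have "M *v x = (\<Sum>l\<in>UNIV. y $ l *s (M *v column l U))"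
    by (simp add: x matrix_mult_sum[of U] M)
  also have "\<dots> = U *v (\<chi> l. d l * y $ l)"
    by (simp add: ev matrix_mult_sum[of U] vector_smult_assoc mult.commute)
  finally show ?thesis
    using matrix_inv_mult[OF inv] by (simp add: coord_def y_def matrix_vector_mul_assoc)
qed

lemma coord_mpow:
  assumes "diagonalized_by M U d"
  shows "coord U l (mpow M q *v x) = d l ^ q * coord U l x"
  by (induction q)
     (simp_all add: mpow_Suc matrix_vector_mul_assoc[symmetric] coord_eigen[OF assms])

lemma coord_column:
  assumes "invertible U"
  shows "coord U l (a *s column l' U) = (if l = l' then a else 0)"
proof -
  have "column l' U = U *v axis l' 1"
    by (simp add: vec_eq_iff matrix_vector_mult_def column_def axis_def if_distrib cong: if_cong)
  then have "coord U l (a *s column l' U) = a * axis l' 1 $ l"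
    using matrix_inv_mult[OF assms]
    by (simp add: coord_def vector_scalar_commute[symmetric] matrix_vector_mul_assoc)
  then show ?thesis by (simp add: axis_def)
qed

lemma eigenvalue_norm_less_1:
  assumes "diagonalized_by M U d" "onorm ((*v) (mpow M q)) < 1"
  shows "cmod (d l) < 1"
proof (rule ccontr)
  assume "\<not> cmod (d l) < 1"
  then have "1 \<le> cmod (d l) ^ q" by (simp add: one_le_power)
  define u where "u = column l U"
  have inv: "invertible U" and ev: "M *v u = d l *s u"
    using assms by (auto simp: diagonalized_by_def u_def)
  have "coord U l u = 1" using coord_column[OF inv, of l 1 l] by (simp add: u_def)
  then have u: "u \<noteq> 0" by auto
  have "mpow M q *v u = d l ^ q *s u"
    by (induction q)
       (simp_all add: mpow_Suc matrix_vector_mul_assoc[symmetric] ev vector_scalar_commute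
          vector_smult_assoc mult.commute)
  then have "norm (d l ^ q *s u) \<le> onorm ((*v) (mpow M q)) * norm u"
    using onorm[OF matrix_vector_mul_bounded_linear, of "mpow M q" u] by simp
  moreover have "norm (a *s v) = cmod a * norm v" for a and v :: "complex ^ 'a"
    by (simp add: norm_vec_def norm_mult L2_set_right_distrib)
  ultimately have "cmod (d l) ^ q * norm u \<le> onorm ((*v) (mpow M q)) * norm u"
    by (simp add: norm_power)
  then have "cmod (d l) ^ q \<le> onorm ((*v) (mpow M q))" using u by simp
  then show False using assms(2) \<open>1 \<le> cmod (d l) ^ q\<close> by simp
qed

lemma eigenvalue_neq_0:
  assumes "diagonalized_by M U d" "invertible M"
  shows "d l \<noteq> 0"
proof
  assume "d l = 0"
  define u where "u = column l U"
  have inv: "invertible U" and ev: "M *v u = d l *s u"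
    using assms by (auto simp: diagonalized_by_def u_def)
  have "coord U l u = 1" using coord_column[OF inv, of l 1 l] by (simp add: u_def)
  moreover have "matrix_inv M *v (M *v u) = u"
    using matrix_inv_mult[OF assms(2)] by (simp add: matrix_vector_mul_assoc)
  ultimately show False using ev \<open>d l = 0\<close> by simp
qed

section \<open>Reduction of the error to scalar coarse sequences\<close>

lemma sum_num_points_div_mod:
  fixes f :: "nat \<Rightarrow> nat \<Rightarrow> real"
  assumes "k \<ge> 1"
  shows "(\<Sum>i<num_points k Nc. f (i div k) (i mod k)) = (\<Sum>m<Nc-1. \<Sum>r<k. f m r) + f (Nc - 1) 0"
proof -
  have "(\<Sum>i<(Nc-1) * k. f (i div k) (i mod k)) = (\<Sum>m<Nc-1. \<Sum>i\<in>{m*k..<m*k+k}. f (i div k) (i mod k))"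
    by (rule sum.nat_group[symmetric])
  also have "\<dots> = (\<Sum>m<Nc-1. \<Sum>r<k. f m r)"
  proof (rule sum.cong)
    fix m
    show "(\<Sum>i\<in>{m*k..<m*k+k}. f (i div k) (i mod k)) = (\<Sum>r<k. f m r)"
      using sum.shift_bounds_nat_ivl[of "\<lambda>i. f (i div k) (i mod k)" 0 "m * k" k] assms
      by (simp add: lessThan_atLeast0 add.commute)
  qed simp
  finally show ?thesis using assms by (simp add: num_points_def)
qed

lemma div_less_of_num_points:
  assumes "k \<ge> 1" "Nc \<ge> 1" "i < num_points k Nc"
  shows "i div k < Nc"
proof -
  have "i \<le> (Nc - 1) * k" using assms by (simp add: num_points_def)
  then have "i div k \<le> (Nc - 1) * k div k" by (rule div_le_mono)
  then show ?thesis using assms by simp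
qed

lemma cpts_eq_image: "k \<ge> 1 \<Longrightarrow> Nc \<ge> 1 \<Longrightarrow> cpts k Nc = (\<lambda>m. m * k) ` {..<Nc}"
  using cpts_iff by blast

definition coarse_coord ::
  "nat \<Rightarrow> complex ^ 'n ^ 'n \<Rightarrow> 'n::finite \<Rightarrow> 'n bvec \<Rightarrow> nat \<Rightarrow> complex" where
  "coarse_coord k U l x m = coord U l (x (m * k))"

text \<open>One basis diagonalizes both matrices, so each block acts on the l-th coordinate as a
  scalar. The columns of F-points are zero, which leaves a convolution over coarse indices.\<close>

lemma coord_E_FCF:
  assumes "k \<ge> 2" "Nc \<ge> 1" "i < num_points k Nc" "diagonalized_by \<Phi> U lam" "diagonalized_by \<Psi> U mu"
  shows "coord U l (bapply {..<num_points k Nc} (E_FCF k Nc \<Phi> \<Psi>) x i)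
    = lam l ^ (i mod k)
      * coarse_op ((lam l ^ k - mu l) * lam l ^ k) (mu l) (coarse_coord k U l x) (i div k)"
proof -
  let ?c = "(lam l ^ k - mu l) * lam l ^ k"
  have k: "k \<ge> 1" using assms by simp
  have iN: "i div k < Nc" using div_less_of_num_points[OF k assms(2,3)] .
  have "coord U l (bapply {..<num_points k Nc} (E_FCF k Nc \<Phi> \<Psi>) x i)
    = (\<Sum>s<num_points k Nc. coord U l (E_FCF k Nc \<Phi> \<Psi> i s *v x s))"
    by (simp add: bapply_def coord_sum)
  also have "\<dots> = (\<Sum>s\<in>cpts k Nc. coord U l (E_FCF k Nc \<Phi> \<Psi> i s *v x s))"
    by (rule sum.mono_neutral_right) (auto simp: cpts_def fpts_def E_FCF_eq_0)
  also have "\<dots> = (\<Sum>s\<in>cpts k Nc. if s div k + 1 < i div k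
      then lam l ^ (i mod k) * ?c * mu l ^ (i div k - s div k - 2) * coord U l (x s) else 0)"
  proof (rule sum.cong)
    fix s assume s: "s \<in> cpts k Nc"
    show "coord U l (E_FCF k Nc \<Phi> \<Psi> i s *v x s) = (if s div k + 1 < i div k
      then lam l ^ (i mod k) * ?c * mu l ^ (i div k - s div k - 2) * coord U l (x s) else 0)"
      by (simp add: E_FCF_eq[OF assms(1,3) s] matrix_vector_mul_assoc[symmetric] coord_mpow[OF assms(4)]
          coord_mpow[OF assms(5)] coord_eigen[OF assms(5)] matrix_vector_mult_diff_rdistrib coord_diff
          algebra_simps)
  qed simp
  also have "\<dots> = (\<Sum>m<Nc. if m + 1 < i div k
      then lam l ^ (i mod k) * ?c * mu l ^ (i div k - m - 2) * coarse_coord k U l x m else 0)"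
    using k by (simp add: cpts_eq_image[OF k assms(2)] sum.reindex inj_on_def coarse_coord_def
        Suc_le_eq cong: if_cong)
  also have "\<dots> = (\<Sum>m<i div k - 1.
      lam l ^ (i mod k) * ?c * mu l ^ (i div k - m - 2) * coarse_coord k U l x m)"
    by (rule sum.mono_neutral_cong_right) (use iN in auto)
  also have "\<dots> = lam l ^ (i mod k) * coarse_op ?c (mu l) (coarse_coord k U l x) (i div k)"
    by (simp add: coarse_op_def sum_distrib_left mult.assoc diff_commute)
  finally show ?thesis .
qed

lemma mgrit_error_Suc:
  "mgrit_error k \<Phi> \<Psi> Nc e0 (Suc p)
    = bapply {..<num_points k Nc} (E_FCF k Nc \<Phi> \<Psi>) (mgrit_error k \<Phi> \<Psi> Nc e0 p)"
  by (simp add: mgrit_error_def)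

text \<open>At a C-point the power of the eigenvalue is 1, so successive errors are linked by the
  coarse operator alone and the extension enters once, at the end. The formula starts at one
  iteration, since the F-values of the initial error are arbitrary.\<close>

lemma coord_mgrit_error:
  assumes "k \<ge> 2" "Nc \<ge> 1" "i < num_points k Nc" "diagonalized_by \<Phi> U lam" "diagonalized_by \<Psi> U mu"
  shows "coord U l (mgrit_error k \<Phi> \<Psi> Nc e0 (Suc p) i)
    = lam l ^ (i mod k)
      * (coarse_op ((lam l ^ k - mu l) * lam l ^ k) (mu l) ^^ Suc p) (coarse_coord k U l e0) (i div k)"
  using assms(3)
proof (induction p arbitrary: i)
  case 0
  then show ?case using coord_E_FCF[OF assms(1,2) _ assms(4,5)] by (simp add: mgrit_error_def)
next
  case (Suc p)
  let ?T = "coarse_op ((lam l ^ k - mu l) * lam l ^ k) (mu l)"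
  let ?e = "mgrit_error k \<Phi> \<Psi> Nc e0 (Suc p)"
  have "coarse_coord k U l ?e m = (?T ^^ Suc p) (coarse_coord k U l e0) m" if "m < Nc" for m
  proof -
    have "m * k < num_points k Nc"
      using cpts_iff[of k Nc "m * k"] that assms(1,2) by (auto simp: cpts_def)
    from Suc.IH[OF this] show ?thesis using assms(1) by (simp add: coarse_coord_def[of _ _ _ ?e] del: funpow.simps)
  qed
  moreover have "i div k < Nc" using div_less_of_num_points[of k Nc i] assms Suc.prems by simp
  ultimately have "?T (coarse_coord k U l ?e) (i div k)
      = ?T ((?T ^^ Suc p) (coarse_coord k U l e0)) (i div k)"
    by (intro coarse_op_cong) simp
  then show ?case
    unfolding mgrit_error_Suc[of _ _ _ _ _ "Suc p"] coord_E_FCF[OF assms(1,2) Suc.prems assms(4,5)]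
    by simp
qed

text \<open>F-relaxation extends a coarse value over its interval by powers of the eigenvalue; the last
  C-point has no F-points after it, hence its weight one.\<close>

definition ext_norm2 :: "real \<Rightarrow> nat \<Rightarrow> (nat \<Rightarrow> complex) \<Rightarrow> real" where
  "ext_norm2 w Nc z = w * (\<Sum>m<Nc-1. (cmod (z m))\<^sup>2) + (cmod (z (Nc - 1)))\<^sup>2"

lemma U_norm_mgrit_error:
  assumes "k \<ge> 2" "Nc \<ge> 1" "diagonalized_by \<Phi> U lam" "diagonalized_by \<Psi> U mu"
  shows "(U_norm k U Nc (mgrit_error k \<Phi> \<Psi> Nc e0 (Suc p)))\<^sup>2
    = (\<Sum>l\<in>UNIV. ext_norm2 (\<Sum>r<k. cmod (lam l) ^ (2 * r)) Nc
        ((coarse_op ((lam l ^ k - mu l) * lam l ^ k) (mu l) ^^ Suc p) (coarse_coord k U l e0)))"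
  unfolding U_norm_sq
proof (rule sum.cong)
  fix l
  let ?z = "(coarse_op ((lam l ^ k - mu l) * lam l ^ k) (mu l) ^^ Suc p) (coarse_coord k U l e0)"
  have "(\<Sum>j<num_points k Nc. (cmod (coord U l (mgrit_error k \<Phi> \<Psi> Nc e0 (Suc p) j)))\<^sup>2)
    = (\<Sum>j<num_points k Nc. cmod (lam l) ^ (2 * (j mod k)) * (cmod (?z (j div k)))\<^sup>2)"
    by (rule sum.cong)
       (use assms in \<open>auto simp: coord_mgrit_error norm_mult norm_power power_mult_distrib
          power_mult[symmetric] mult.commute simp del: funpow.simps\<close>)
  also have "\<dots> = (\<Sum>m<Nc-1. \<Sum>r<k. cmod (lam l) ^ (2 * r) * (cmod (?z m))\<^sup>2) + (cmod (?z (Nc - 1)))\<^sup>2"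
    using sum_num_points_div_mod[of k "\<lambda>m r. cmod (lam l) ^ (2 * r) * (cmod (?z m))\<^sup>2" Nc] assms(1)
    by (simp del: funpow.simps)
  also have "\<dots> = ext_norm2 (\<Sum>r<k. cmod (lam l) ^ (2 * r)) Nc ?z"
    by (simp add: ext_norm2_def sum_distrib_left sum_distrib_right del: funpow.simps)
  finally show "(\<Sum>j<num_points k Nc. (cmod (coord U l (mgrit_error k \<Phi> \<Psi> Nc e0 (Suc p) j)))\<^sup>2)
    = ext_norm2 (\<Sum>r<k. cmod (lam l) ^ (2 * r)) Nc ?z" .
qed simp

lemma coarse_coord_norm_le_U_norm:
  assumes "k \<ge> 1" "Nc \<ge> 1"
  shows "(\<Sum>l\<in>UNIV. \<Sum>m<Nc. (cmod (coarse_coord k U l x m))\<^sup>2) \<le> (U_norm k U Nc x)\<^sup>2"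
  unfolding U_norm_sq
proof (rule sum_mono)
  fix l
  have "(\<Sum>m<Nc. (cmod (coarse_coord k U l x m))\<^sup>2) = (\<Sum>j\<in>cpts k Nc. (cmod (coord U l (x j)))\<^sup>2)"
    using assms by (simp add: cpts_eq_image sum.reindex inj_on_def coarse_coord_def)
  also have "\<dots> \<le> (\<Sum>j<num_points k Nc. (cmod (coord U l (x j)))\<^sup>2)"
    by (rule sum_mono2) (auto simp: cpts_def)
  finally show "(\<Sum>m<Nc. (cmod (coarse_coord k U l x m))\<^sup>2)
    \<le> (\<Sum>j<num_points k Nc. (cmod (coord U l (x j)))\<^sup>2)" .
qed

section \<open>Error bounds\<close>

lemma bapply_bidiag:
  assumes "i < N"
  shows "bapply {..<N} (bidiag T) x i = x i - (if i > 0 then T *v x (i - 1) else 0)"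
proof (cases i)
  case 0
  have "bapply {..<N} (bidiag T) x i = (\<Sum>s<N. if s = i then x s else 0)"
    unfolding bapply_def by (rule sum.cong) (auto simp: bidiag_def 0)
  then show ?thesis using assms 0 by simp
next
  case (Suc i')
  have neg: "(- T) *v y = - (T *v y)" for y
    using matrix_vector_mult_diff_rdistrib[of 0 T y] by simp
  have "bapply {..<N} (bidiag T) x i
    = (\<Sum>s<N. if s = i then x s else if s = i' then - (T *v x s) else 0)"
    unfolding bapply_def by (rule sum.cong) (auto simp: bidiag_def Suc neg)
  also have "\<dots> = (if i \<in> {..<N} then x i else 0) + (if i' \<in> {..<N} then - (T *v x i') else 0)"
    using Suc by (intro sum_if_eq_if_eq) auto
  finally show ?thesis using assms Suc by simp
qed

text \<open>Scalar time stepping is the same two-term difference as before, so the summed identity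
  yields the lower bound once its nonnegative terms are dropped. The constants do not depend on
  N.\<close>

lemma bidiag_norm_bounds:
  fixes x :: "nat \<Rightarrow> complex"
  assumes "cmod \<mu> < 1"
  shows "(1 - cmod \<mu>)\<^sup>2 * (\<Sum>m<N. (cmod (x m))\<^sup>2)
      \<le> (\<Sum>m<N. (cmod (x m - (if m > 0 then \<mu> * x (m - 1) else 0)))\<^sup>2)" (is ?lower)
    and "(\<Sum>m<N. (cmod (x m - (if m > 0 then \<mu> * x (m - 1) else 0)))\<^sup>2)
      \<le> 4 * (\<Sum>m<N. (cmod (x m))\<^sup>2)" (is ?upper)
proof -
  \<comment> \<open>The prefixed zero supplies the initial condition of the identity and absorbs the
    missing predecessor at m = 0.\<close>
  define z where "z = case_nat 0 x"
  obtain \<omega> where \<omega>: "cmod \<omega> = 1" "\<mu> = of_real (cmod \<mu>) * \<omega>" by (rule complex_polar_obtain)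
  have z: "x m - (if m > 0 then \<mu> * x (m - 1) else 0) = z (Suc m) - \<mu> * z m" for m
    by (cases m) (auto simp: z_def)
  have s: "(\<Sum>m<Suc N. (cmod (z m))\<^sup>2) = (\<Sum>m<N. (cmod (x m))\<^sup>2)"
    by (simp add: z_def sum.lessThan_Suc_shift del: sum.lessThan_Suc)
  have "0 \<le> cmod \<mu> * (1 - cmod \<mu>) * (cmod (z N))\<^sup>2
      + cmod \<mu> * (\<Sum>m<N. (cmod (z (Suc m) - \<omega> * z m))\<^sup>2)"
    using assms by (simp add: sum_nonneg)
  then show ?lower
    unfolding z using sum_norm_diff_mult_sq[OF \<omega>, of z N] unfolding s by (simp add: z_def)
  have "(cmod (z (Suc m) - \<mu> * z m))\<^sup>2 \<le> 2 * (cmod (z (Suc m)))\<^sup>2 + 2 * (cmod (z m))\<^sup>2" for m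
  proof -
    have "cmod (z (Suc m) - \<mu> * z m) \<le> cmod (z (Suc m)) + cmod (\<mu> * z m)"
      by (rule norm_triangle_ineq4)
    also have "\<dots> \<le> cmod (z (Suc m)) + cmod (z m)"
      using assms by (simp add: norm_mult mult_left_le_one_le)
    finally have "(cmod (z (Suc m) - \<mu> * z m))\<^sup>2 \<le> (cmod (z (Suc m)) + cmod (z m))\<^sup>2"
      by (simp add: power_mono)
    also have "\<dots> \<le> 2 * (cmod (z (Suc m)))\<^sup>2 + 2 * (cmod (z m))\<^sup>2"
      using sum_squares_bound[of "cmod (z (Suc m))" "cmod (z m)"] by (simp add: power2_sum)
    finally show ?thesis .
  qed
  then have "(\<Sum>m<N. (cmod (z (Suc m) - \<mu> * z m))\<^sup>2)
    \<le> (\<Sum>m<N. 2 * (cmod (z (Suc m)))\<^sup>2 + 2 * (cmod (z m))\<^sup>2)"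
    by (intro sum_mono)
  also have "\<dots> = 2 * (\<Sum>m<N. (cmod (x m))\<^sup>2) + 2 * (\<Sum>m<N. (cmod (z m))\<^sup>2)"
    by (simp add: sum.distrib sum_distrib_left z_def)
  also have "(\<Sum>m<N. (cmod (z m))\<^sup>2) \<le> (\<Sum>m<N. (cmod (x m))\<^sup>2)"
    unfolding s[symmetric] by simp
  finally show ?upper unfolding z by simp
qed

lemma sum_lessThan_pred:
  fixes f :: "nat \<Rightarrow> real"
  shows "Nc \<ge> 1 \<Longrightarrow> (\<Sum>m<Nc. f m) = (\<Sum>m<Nc-1. f m) + f (Nc - 1)"
  by (cases Nc) auto

lemma sum_le_ext_norm2:
  assumes "w \<ge> 1" "Nc \<ge> 1"
  shows "(\<Sum>m<Nc. (cmod (z m))\<^sup>2) \<le> ext_norm2 w Nc z"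
  using mult_right_mono[OF assms(1), of "\<Sum>m<Nc-1. (cmod (z m))\<^sup>2"] assms(2)
  by (simp add: ext_norm2_def sum_lessThan_pred sum_nonneg)

lemma ext_norm2_le_sum:
  assumes "w \<ge> 1" "Nc \<ge> 1"
  shows "ext_norm2 w Nc z \<le> w * (\<Sum>m<Nc. (cmod (z m))\<^sup>2)"
  using assms
  by (auto simp: ext_norm2_def sum_lessThan_pred distrib_left mult_le_cancel_right1)

lemma ext_norm2_eq_sum:
  assumes "z (Nc - 1) = 0" "Nc \<ge> 1"
  shows "ext_norm2 w Nc z = w * (\<Sum>m<Nc. (cmod (z m))\<^sup>2)"
  using assms by (simp add: ext_norm2_def sum_lessThan_pred)

text \<open>The last entry of the argument has the smallest weight but does not influence the image, so
  the weights do not spoil the unweighted bound.\<close>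

lemma ext_norm2_coarse_op_le:
  assumes "cmod \<mu> < 1" "cmod c \<le> \<phi> * (1 - cmod \<mu>)" "Nc \<ge> 1" "w \<ge> 1"
  shows "ext_norm2 w Nc (coarse_op c \<mu> y) \<le> \<phi>\<^sup>2 * (1 - cmod \<mu> / (real Nc)\<^sup>2) * (w * (\<Sum>m<Nc-2. (cmod (y m))\<^sup>2))"
proof -
  have "ext_norm2 w Nc (coarse_op c \<mu> y) \<le> w * (\<Sum>m<Nc. (cmod (coarse_op c \<mu> y m))\<^sup>2)"
    using assms by (intro ext_norm2_le_sum)
  also have "\<dots> \<le> w * (\<phi>\<^sup>2 * (1 - cmod \<mu> / (real Nc)\<^sup>2) * (\<Sum>m<Nc-2. (cmod (y m))\<^sup>2))"
    using assms by (intro mult_left_mono coarse_op_norm_le) auto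
  finally show ?thesis by (simp add: mult_ac)
qed

lemma gap_factor_nonneg:
  assumes "0 \<le> r" "r \<le> 1" "Nc \<ge> 1"
  shows "0 \<le> 1 - r / (real Nc)\<^sup>2"
proof -
  have "1 \<le> (real Nc)\<^sup>2" using assms by simp
  then have "r \<le> (real Nc)\<^sup>2" using assms by linarith
  then show ?thesis using \<open>1 \<le> (real Nc)\<^sup>2\<close> by (simp add: divide_le_eq)
qed

text \<open>A common r below all |\<mu>| will give the same factor for every eigenvalue, so that the
  components can be summed.\<close>

lemma ext_norm2_coarse_op_pow_le:
  assumes "cmod \<mu> < 1" "cmod c \<le> \<phi> * (1 - cmod \<mu>)" "Nc \<ge> 1" "w \<ge> 1" "0 \<le> r" "r \<le> cmod \<mu>"
  shows "ext_norm2 w Nc ((coarse_op c \<mu> ^^ p) y) \<le> (\<phi>\<^sup>2 * (1 - r / (real Nc)\<^sup>2)) ^ p * ext_norm2 w Nc y"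
proof (induction p)
  case (Suc p)
  define v where "v = (coarse_op c \<mu> ^^ p) y"
  have nn: "0 \<le> 1 - r / (real Nc)\<^sup>2" using assms by (intro gap_factor_nonneg) auto
  have "ext_norm2 w Nc (coarse_op c \<mu> v)
    \<le> \<phi>\<^sup>2 * (1 - cmod \<mu> / (real Nc)\<^sup>2) * (w * (\<Sum>m<Nc-2. (cmod (v m))\<^sup>2))"
    using assms by (intro ext_norm2_coarse_op_le)
  also have "\<dots> \<le> \<phi>\<^sup>2 * (1 - r / (real Nc)\<^sup>2) * ext_norm2 w Nc v"
  proof (rule mult_mono)
    have "(\<Sum>m<Nc-2. (cmod (v m))\<^sup>2) \<le> (\<Sum>m<Nc-1. (cmod (v m))\<^sup>2)"
      by (rule sum_mono2) auto
    then have "w * (\<Sum>m<Nc-2. (cmod (v m))\<^sup>2) \<le> w * (\<Sum>m<Nc-1. (cmod (v m))\<^sup>2)"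
      using assms(4) by (intro mult_left_mono) auto
    then show "w * (\<Sum>m<Nc-2. (cmod (v m))\<^sup>2) \<le> ext_norm2 w Nc v"
      using zero_le_power2[of "cmod (v (Nc - 1))"] unfolding ext_norm2_def by linarith
    show "\<phi>\<^sup>2 * (1 - cmod \<mu> / (real Nc)\<^sup>2) \<le> \<phi>\<^sup>2 * (1 - r / (real Nc)\<^sup>2)"
      using assms by (intro mult_left_mono diff_left_mono divide_right_mono) auto
  qed (use nn assms in \<open>auto intro!: mult_nonneg_nonneg sum_nonneg\<close>)
  also have "\<dots> \<le> \<phi>\<^sup>2 * (1 - r / (real Nc)\<^sup>2) * ((\<phi>\<^sup>2 * (1 - r / (real Nc)\<^sup>2)) ^ p * ext_norm2 w Nc y)"
    using Suc nn by (intro mult_left_mono) (auto simp: v_def)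
  finally show ?case by (simp add: v_def mult.assoc)
qed simp

lemma coarse_op_pow_0: "(coarse_op c \<mu> ^^ p) (\<lambda>_. 0) = (\<lambda>_. 0)"
  by (induction p) (auto simp: coarse_op_def)

text \<open>An initial error along one eigenvector and zero at F-points; it realizes an arbitrary
  scalar sequence as coarse coordinates.\<close>

definition eigen_error :: "nat \<Rightarrow> complex ^ 'n ^ 'n \<Rightarrow> 'n::finite \<Rightarrow> (nat \<Rightarrow> complex) \<Rightarrow> 'n bvec" where
  "eigen_error k U l x i = (if k dvd i then x (i div k) *s column l U else 0)"

section \<open>Error bounds in the eigenvector norm\<close>

locale diagonalized_mgrit =
  fixes \<Phi> \<Psi> U :: "complex ^ 'n ^ 'n"
    and lam mu :: "'n::finite \<Rightarrow> complex"
    and \<phi> :: real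
    and k :: nat
  assumes k: "k \<ge> 2"
    and diag: "diagonalized_by \<Phi> U lam" "diagonalized_by \<Psi> U mu"
    and lam: "cmod (lam l) < 1" "lam l \<noteq> 0"
    and mu: "cmod (mu l) < 1" "mu l \<noteq> 0"
    and teap: "fcf_teap k lam mu \<phi>"
begin

abbreviation "err \<equiv> mgrit_error k \<Phi> \<Psi>"
abbreviation "nrm \<equiv> U_norm k U"

definition "c l = (lam l ^ k - mu l) * lam l ^ k"
definition "w l = (\<Sum>r<k. cmod (lam l) ^ (2 * r))"
definition "min_mu = Min (range (\<lambda>l. cmod (mu l)))"

lemma invU: "invertible U"
  using diag by (simp add: diagonalized_by_def)

text \<open>Multiplying by the nonzero |\<lambda>^k| turns the TEAP into exactly the hypothesis of
  the scalar bounds.\<close>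

lemma fcf_teap_iff: "fcf_teap k lam mu \<psi> \<longleftrightarrow> (\<forall>l. cmod (c l) \<le> \<psi> * (1 - cmod (mu l)))"
proof -
  have "cmod (mu l - lam l ^ k) \<le> \<psi> * ((1 - cmod (mu l)) / cmod (lam l ^ k))
    \<longleftrightarrow> cmod (c l) \<le> \<psi> * (1 - cmod (mu l))" for l
    using lam(2)[of l] by (simp add: c_def norm_mult norm_minus_commute pos_le_divide_eq)
  then show ?thesis by (simp add: fcf_teap_def)
qed

lemma c_le: "cmod (c l) \<le> \<phi> * (1 - cmod (mu l))"
  using teap fcf_teap_iff by blast

lemma phi_nonneg: "0 \<le> \<phi>"
proof -
  have "0 \<le> \<phi> * (1 - cmod (mu undefined))"
    using c_le by (rule order_trans[OF norm_ge_zero])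
  then show ?thesis using mu(1)[of undefined] by (simp add: zero_le_mult_iff)
qed

lemma w_bounds: "1 \<le> w l" "w l \<le> real k"
proof -
  have "(\<Sum>r\<in>{0}. cmod (lam l) ^ (2 * r)) \<le> w l"
    unfolding w_def using k by (intro sum_mono2) auto
  then show "1 \<le> w l" by simp
  have "w l \<le> (\<Sum>r<k. 1)"
    unfolding w_def using lam(1)[of l] by (intro sum_mono power_le_one) auto
  then show "w l \<le> real k" by simp
qed

lemma min_mu: "0 < min_mu" "min_mu \<le> cmod (mu l)" "min_mu \<le> 1"
proof -
  have "min_mu \<in> range (\<lambda>l. cmod (mu l))" unfolding min_mu_def by (intro Min_in) auto
  then obtain l' where "min_mu = cmod (mu l')" by blast
  then show "0 < min_mu" "min_mu \<le> 1" using mu[of l'] by simp_all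
  show "min_mu \<le> cmod (mu l)" unfolding min_mu_def by (intro Min_le) auto
qed

lemma nrm_err:
  assumes "Nc \<ge> 1"
  shows "(nrm Nc (err Nc e0 (Suc p)))\<^sup>2
    = (\<Sum>l\<in>UNIV. ext_norm2 (w l) Nc ((coarse_op (c l) (mu l) ^^ Suc p) (coarse_coord k U l e0)))"
  unfolding c_def w_def by (rule U_norm_mgrit_error[OF k assms diag])

text \<open>The initial error may live on C-points alone and then carries no extension weights,
  while the first error carries the weights w \<le> k; hence the factor k, at this step
  only.\<close>

lemma nrm_err_1_le:
  assumes "Nc \<ge> 1"
  shows "(nrm Nc (err Nc e0 1))\<^sup>2 \<le> real k * \<phi>\<^sup>2 * (nrm Nc e0)\<^sup>2"
proof -
  have "(nrm Nc (err Nc e0 1))\<^sup>2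
    = (\<Sum>l\<in>UNIV. ext_norm2 (w l) Nc (coarse_op (c l) (mu l) (coarse_coord k U l e0)))"
    using nrm_err[OF assms, of e0 0] by simp
  also have "\<dots> \<le> (\<Sum>l\<in>UNIV. real k * \<phi>\<^sup>2 * (\<Sum>m<Nc. (cmod (coarse_coord k U l e0 m))\<^sup>2))"
  proof (rule sum_mono)
    fix l
    let ?y = "coarse_coord k U l e0"
    have "ext_norm2 (w l) Nc (coarse_op (c l) (mu l) ?y)
      \<le> \<phi>\<^sup>2 * (1 - cmod (mu l) / (real Nc)\<^sup>2) * (w l * (\<Sum>m<Nc-2. (cmod (?y m))\<^sup>2))"
      using assms mu c_le w_bounds by (intro ext_norm2_coarse_op_le) auto
    also have "\<dots> \<le> \<phi>\<^sup>2 * 1 * (real k * (\<Sum>m<Nc. (cmod (?y m))\<^sup>2))"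
      using w_bounds[of l] gap_factor_nonneg[of "cmod (mu l)" Nc] mu(1)[of l] assms
      by (intro mult_mono sum_mono2 mult_left_mono) (auto intro!: mult_nonneg_nonneg sum_nonneg)
    finally show "ext_norm2 (w l) Nc (coarse_op (c l) (mu l) ?y)
      \<le> real k * \<phi>\<^sup>2 * (\<Sum>m<Nc. (cmod (?y m))\<^sup>2)" by (simp add: mult_ac)
  qed
  also have "\<dots> = real k * \<phi>\<^sup>2 * (\<Sum>l\<in>UNIV. \<Sum>m<Nc. (cmod (coarse_coord k U l e0 m))\<^sup>2)"
    by (simp add: sum_distrib_left)
  also have "\<dots> \<le> real k * \<phi>\<^sup>2 * (nrm Nc e0)\<^sup>2"
    using coarse_coord_norm_le_U_norm[of k Nc U e0] k assms by (intro mult_left_mono) auto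
  finally show ?thesis .
qed

text \<open>From the first error on, both sides carry the same weights, so no further factor k
  appears.\<close>

lemma nrm_err_Suc_le:
  assumes "Nc \<ge> 1"
  shows "(nrm Nc (err Nc e0 (Suc p)))\<^sup>2
    \<le> (\<phi>\<^sup>2 * (1 - min_mu / (real Nc)\<^sup>2)) ^ p * (nrm Nc (err Nc e0 1))\<^sup>2"
proof -
  have "(nrm Nc (err Nc e0 (Suc p)))\<^sup>2
    = (\<Sum>l\<in>UNIV. ext_norm2 (w l) Nc ((coarse_op (c l) (mu l) ^^ p)
        (coarse_op (c l) (mu l) (coarse_coord k U l e0))))"
    unfolding nrm_err[OF assms] funpow_Suc_right by simp
  also have "\<dots> \<le> (\<Sum>l\<in>UNIV. (\<phi>\<^sup>2 * (1 - min_mu / (real Nc)\<^sup>2)) ^ p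
      * ext_norm2 (w l) Nc (coarse_op (c l) (mu l) (coarse_coord k U l e0)))"
    using assms mu c_le w_bounds min_mu
    by (intro sum_mono ext_norm2_coarse_op_pow_le) (auto intro: less_imp_le)
  also have "\<dots> = (\<phi>\<^sup>2 * (1 - min_mu / (real Nc)\<^sup>2)) ^ p * (nrm Nc (err Nc e0 1))\<^sup>2"
    using nrm_err[OF assms, of e0 0] by (simp add: sum_distrib_left)
  finally show ?thesis .
qed

lemma nrm_err_gap:
  assumes "Nc \<ge> 1" "p \<ge> 1"
  shows "(nrm Nc (err Nc e0 (Suc p)))\<^sup>2
    \<le> (\<phi> ^ (2 * p) - \<phi> ^ (2 * p) * min_mu / (real Nc)\<^sup>2) * (nrm Nc (err Nc e0 1))\<^sup>2"
proof -
  let ?t = "1 - min_mu / (real Nc)\<^sup>2"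
  have t: "0 \<le> ?t" "?t \<le> 1"
    using gap_factor_nonneg[of min_mu Nc] min_mu assms by auto
  \<comment> \<open>One of the p gap factors already gives the order 1/Nc^2; this is where p \<ge> 1
    enters.\<close>
  have "?t ^ p \<le> ?t ^ 1" using t assms(2) by (intro power_decreasing) auto
  then have "\<phi> ^ (2 * p) * ?t ^ p \<le> \<phi> ^ (2 * p) * ?t"
    using phi_nonneg by (intro mult_left_mono) auto
  moreover have "(\<phi>\<^sup>2 * ?t) ^ p = \<phi> ^ (2 * p) * ?t ^ p"
    by (simp only: power_mult_distrib power_mult)
  ultimately have "(\<phi>\<^sup>2 * ?t) ^ p \<le> \<phi> ^ (2 * p) - \<phi> ^ (2 * p) * min_mu / (real Nc)\<^sup>2"
    by (simp add: right_diff_distrib)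
  then have "(\<phi>\<^sup>2 * ?t) ^ p * (nrm Nc (err Nc e0 1))\<^sup>2
    \<le> (\<phi> ^ (2 * p) - \<phi> ^ (2 * p) * min_mu / (real Nc)\<^sup>2) * (nrm Nc (err Nc e0 1))\<^sup>2"
    by (intro mult_right_mono) auto
  with nrm_err_Suc_le[OF assms(1)] show ?thesis by (rule order_trans)
qed

lemma nrm_err_le:
  assumes "Nc \<ge> 1"
  shows "(nrm Nc (err Nc e0 (Suc p)))\<^sup>2 \<le> \<phi> ^ (2 * p) * (nrm Nc (err Nc e0 1))\<^sup>2"
proof (cases "p = 0")
  case False
  then have "(nrm Nc (err Nc e0 (Suc p)))\<^sup>2
    \<le> (\<phi> ^ (2 * p) - \<phi> ^ (2 * p) * min_mu / (real Nc)\<^sup>2) * (nrm Nc (err Nc e0 1))\<^sup>2"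
    using assms by (intro nrm_err_gap) auto
  also have "\<dots> \<le> \<phi> ^ (2 * p) * (nrm Nc (err Nc e0 1))\<^sup>2"
    using min_mu(1) phi_nonneg by (intro mult_right_mono) auto
  finally show ?thesis .
qed simp

lemma coarse_coord_eigen_error:
  "coarse_coord k U l' (eigen_error k U l x) = (if l' = l then x else (\<lambda>_. 0))"
  using k by (auto simp: coarse_coord_def eigen_error_def coord_column[OF invU] fun_eq_iff)

lemma nrm_err_eigen_error:
  assumes "Nc \<ge> 1"
  shows "(nrm Nc (err Nc (eigen_error k U l x) (Suc p)))\<^sup>2
    = ext_norm2 (w l) Nc ((coarse_op (c l) (mu l) ^^ Suc p) x)"
proof -
  have "(nrm Nc (err Nc (eigen_error k U l x) (Suc p)))\<^sup>2
    = (\<Sum>l'\<in>UNIV. if l' = l then ext_norm2 (w l) Nc ((coarse_op (c l) (mu l) ^^ Suc p) x) else 0)"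
    unfolding nrm_err[OF assms]
    by (rule sum.cong)
       (auto simp: coarse_coord_eigen_error coarse_op_pow_0 ext_norm2_def simp del: funpow.simps)
  then show ?thesis by simp
qed

lemma nrm_eigen_error:
  assumes "Nc \<ge> 1"
  shows "(nrm Nc (eigen_error k U l x))\<^sup>2 = (\<Sum>m<Nc. (cmod (x m))\<^sup>2)"
proof -
  have k1: "k \<ge> 1" using k by simp
  have "(nrm Nc (eigen_error k U l x))\<^sup>2
    = (\<Sum>l'\<in>UNIV. if l' = l then \<Sum>j<num_points k Nc. (cmod (coord U l (eigen_error k U l x j)))\<^sup>2 else 0)"
    unfolding U_norm_sq
    by (rule sum.cong) (auto simp: eigen_error_def coord_column[OF invU] intro!: sum.neutral)
  also have "\<dots> = (\<Sum>j<num_points k Nc. (cmod (coord U l (eigen_error k U l x j)))\<^sup>2)" by simp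
  also have "\<dots> = (\<Sum>j\<in>cpts k Nc. (cmod (x (j div k)))\<^sup>2)"
    by (rule sum.mono_neutral_cong_right)
       (auto simp: cpts_def eigen_error_def coord_column[OF invU])
  also have "\<dots> = (\<Sum>m<Nc. (cmod (x m))\<^sup>2)"
    using k by (simp add: cpts_eq_image[OF k1 assms] sum.reindex inj_on_def)
  finally show ?thesis .
qed

text \<open>A unit impulse at the first C-point arrives with value c two coarse points later, which
  lies on the grid once \<open>Nc\<close> \<ge> 3.\<close>

lemma exists_nrm_err_1_pos:
  assumes "c l \<noteq> 0" "Nc \<ge> 3"
  shows "\<exists>e0. nrm Nc (err Nc e0 1) > 0"
proof -
  define x where "x m = (if m = 0 then 1 else 0 :: complex)" for m :: nat
  let ?z = "coarse_op (c l) (mu l) x"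
  have "?z (Suc (Suc 0)) = c l" unfolding coarse_op_Suc_Suc by (simp add: x_def)
  then have "0 < (cmod (?z 2))\<^sup>2" using assms by (simp add: numeral_2_eq_2)
  also have "\<dots> \<le> (\<Sum>m<Nc. (cmod (?z m))\<^sup>2)"
    using assms(2) by (intro member_le_sum) auto
  also have "\<dots> \<le> ext_norm2 (w l) Nc ?z"
    using w_bounds assms by (intro sum_le_ext_norm2) auto
  also have "\<dots> = (nrm Nc (err Nc (eigen_error k U l x) 1))\<^sup>2"
    using nrm_err_eigen_error[of Nc l x 0] assms by simp
  finally show ?thesis
    by (metis U_norm_nonneg less_eq_real_def zero_less_power2 order_less_le)
qed

lemma nrm_pos_of_err_1_pos:
  assumes "Nc \<ge> 1" "nrm Nc (err Nc e0 1) > 0"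
  shows "nrm Nc e0 > 0"
proof (rule ccontr)
  assume "\<not> nrm Nc e0 > 0"
  then have "nrm Nc e0 = 0" using U_norm_nonneg[of k U Nc e0] by linarith
  then have "(nrm Nc (err Nc e0 1))\<^sup>2 \<le> 0" using nrm_err_1_le[OF assms(1), of e0] by simp
  then show False using assms(2) by simp
qed

text \<open>The final error is prescribed and the initial error is its preimage. Comparison with the
  first error serves tightness, comparison with the initial error serves necessity of \<phi> <
  1.\<close>

lemma near_extremal_error:
  assumes "\<phi> > 0" "cmod (c l) = \<phi> * (1 - cmod (mu l))"
  shows "\<exists>C\<ge>0. \<exists>N0\<ge>3. \<forall>Nc\<ge>N0. \<exists>e0. nrm Nc (err Nc e0 (Suc p)) > 0
    \<and> (nrm Nc (err Nc e0 1))\<^sup>2 \<le> (1 / \<phi> ^ (2 * p) + C / (real Nc)\<^sup>2) * (nrm Nc (err Nc e0 (Suc p)))\<^sup>2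
    \<and> (nrm Nc e0)\<^sup>2 \<le> (1 / \<phi> ^ (2 * Suc p) + C / (real Nc)\<^sup>2) * (nrm Nc (err Nc e0 (Suc p)))\<^sup>2"
proof -
  let ?S = "coarse_inv (c l) (mu l)" and ?T = "coarse_op (c l) (mu l)"
  let ?B = "\<lambda>Nc z. \<Sum>m<Nc. (cmod (z m))\<^sup>2"
  have c0: "c l \<noteq> 0" using assms mu(1)[of l] by auto
  obtain C where C: "C \<ge> 0" and ex: "\<And>N. N \<ge> 8 * (2 * Suc p + 4) \<Longrightarrow>
    \<exists>z. (\<forall>m < 2 * Suc p + 2. z m = 0) \<and> (\<forall>m\<ge>N-1. z m = 0) \<and> ?B N z > 0
    \<and> (\<forall>i\<le>Suc p. ?B N ((?S ^^ i) z) \<le> (1 / \<phi> ^ (2 * i) + C / (real N)\<^sup>2) * ?B N z)"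
    using near_extremal_sequence[OF assms(1) mu(1) assms(2), of "Suc p"] by blast
  have "\<exists>e0. nrm Nc (err Nc e0 (Suc p)) > 0
    \<and> (nrm Nc (err Nc e0 1))\<^sup>2 \<le> (1 / \<phi> ^ (2 * p) + C / (real Nc)\<^sup>2) * (nrm Nc (err Nc e0 (Suc p)))\<^sup>2
    \<and> (nrm Nc e0)\<^sup>2 \<le> (1 / \<phi> ^ (2 * Suc p) + C / (real Nc)\<^sup>2) * (nrm Nc (err Nc e0 (Suc p)))\<^sup>2"
    if Nc: "Nc \<ge> 8 * (2 * Suc p + 4)" for Nc
  proof -
    obtain z where lo: "\<And>m. m < 2 * Suc p + 2 \<Longrightarrow> z m = 0" and hi: "\<And>m. m \<ge> Nc - 1 \<Longrightarrow> z m = 0"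
      and pos: "?B Nc z > 0"
      and B: "\<And>i. i \<le> Suc p \<Longrightarrow> ?B Nc ((?S ^^ i) z) \<le> (1 / \<phi> ^ (2 * i) + C / (real Nc)\<^sup>2) * ?B Nc z"
      using ex[OF Nc] by blast
    have Nc1: "Nc \<ge> 1" using Nc by simp
    define x where "x = (?S ^^ Suc p) z"
    define e0 where "e0 = eigen_error k U l x"
    have "(?T ^^ Suc p) x = z"
      using coarse_op_pow_coarse_inv_pow[OF c0, of 0 "Suc p" z "mu l"] lo
      by (simp add: x_def del: funpow.simps)
    then have ep: "(nrm Nc (err Nc e0 (Suc p)))\<^sup>2 = w l * ?B Nc z"
      unfolding e0_def nrm_err_eigen_error[OF Nc1] using hi Nc1 by (simp add: ext_norm2_eq_sum)
    have "(?T ^^ Suc 0) x = (?S ^^ p) z"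
      using coarse_op_pow_coarse_inv_pow[OF c0, of p 1 z "mu l"] lo by (simp add: x_def)
    \<comment> \<open>As the last entry vanishes, its different weight is harmless and w is a common
      factor of both norms.\<close>
    moreover have "(?S ^^ p) z (Nc - 1) = 0"
      using hi by (intro coarse_inv_pow_eq_0_above[of "Nc - 1"]) auto
    ultimately have e1: "(nrm Nc (err Nc e0 1))\<^sup>2 = w l * ?B Nc ((?S ^^ p) z)"
      unfolding e0_def One_nat_def nrm_err_eigen_error[OF Nc1]
      using Nc1 by (simp add: ext_norm2_eq_sum del: funpow.simps)
    have "(nrm Nc e0)\<^sup>2 \<le> (1 / \<phi> ^ (2 * Suc p) + C / (real Nc)\<^sup>2) * ?B Nc z"
      unfolding e0_def nrm_eigen_error[OF Nc1] x_def by (rule B) simp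
    also have "\<dots> \<le> (1 / \<phi> ^ (2 * Suc p) + C / (real Nc)\<^sup>2) * (w l * ?B Nc z)"
      using w_bounds(1)[of l] pos C assms(1)
      by (intro mult_left_mono) (auto simp: mult_le_cancel_right1)
    finally have n0: "(nrm Nc e0)\<^sup>2 \<le> (1 / \<phi> ^ (2 * Suc p) + C / (real Nc)\<^sup>2) * (nrm Nc (err Nc e0 (Suc p)))\<^sup>2"
      unfolding ep .
    have "w l * ?B Nc ((?S ^^ p) z) \<le> w l * ((1 / \<phi> ^ (2 * p) + C / (real Nc)\<^sup>2) * ?B Nc z)"
      using B[of p] w_bounds(1)[of l] by (intro mult_left_mono) auto
    then have n1: "(nrm Nc (err Nc e0 1))\<^sup>2 \<le> (1 / \<phi> ^ (2 * p) + C / (real Nc)\<^sup>2) * (nrm Nc (err Nc e0 (Suc p)))\<^sup>2"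
      unfolding e1 ep by (simp add: mult_ac)
    have "(nrm Nc (err Nc e0 (Suc p)))\<^sup>2 > 0"
      unfolding ep using pos w_bounds(1)[of l] by simp
    then have "nrm Nc (err Nc e0 (Suc p)) > 0"
      using U_norm_nonneg[of k U Nc "err Nc e0 (Suc p)"] by (simp add: less_le)
    with n0 n1 show ?thesis by blast
  qed
  then show ?thesis using C by (intro exI[of _ C] exI[of _ "8 * (2 * Suc p + 4)"] conjI) auto
qed

text \<open>The least constant is a maximum over finitely many eigenvalues. An eigenvalue where it
  is attained carries the extremal errors.\<close>

lemma best_fcf_teap_attained:
  assumes "best_fcf_teap k lam mu \<phi>"
  shows "\<exists>l. cmod (c l) = \<phi> * (1 - cmod (mu l))"
proof -
  let ?f = "\<lambda>l. cmod (c l) / (1 - cmod (mu l))"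
  define \<psi> where "\<psi> = Max (range ?f)"
  have "?f l \<le> \<psi>" for l unfolding \<psi>_def by (intro Max_ge) auto
  then have "fcf_teap k lam mu \<psi>"
    using mu(1) by (simp add: fcf_teap_iff divide_le_eq)
  then have "\<phi> \<le> \<psi>" using assms by (simp add: best_fcf_teap_def)
  have "\<psi> \<in> range ?f" unfolding \<psi>_def by (intro Max_in) auto
  then obtain l where "\<psi> = ?f l" by auto
  then have "cmod (c l) = \<psi> * (1 - cmod (mu l))" using mu(1)[of l] by simp
  moreover have "\<phi> * (1 - cmod (mu l)) \<le> \<psi> * (1 - cmod (mu l))"
    using \<open>\<phi> \<le> \<psi>\<close> mu(1)[of l] by (intro mult_right_mono) auto
  ultimately show ?thesis using c_le[of l] by (intro exI[of _ l]) linarith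
qed

lemma asymp_convergent_U_norm:
  assumes "\<phi> < 1"
  shows "asymp_convergent k \<Phi> \<Psi> nrm"
  unfolding asymp_convergent_def
proof (intro allI impI)
  fix \<epsilon> :: real assume \<epsilon>: "\<epsilon> > 0"
  have phi2: "\<phi>\<^sup>2 < 1" using assms phi_nonneg by (simp add: power_less_one_iff)
  \<comment> \<open>Dividing by k pays for the possible growth in the first iteration, which is why
    \<open>Suc P\<close> iterations are used.\<close>
  obtain P where P: "(\<phi>\<^sup>2) ^ P < \<epsilon>\<^sup>2 / real k"
    using real_arch_pow_inv[OF _ phi2, of "\<epsilon>\<^sup>2 / real k"] \<epsilon> k by auto
  have "nrm Nc (err Nc e0 p) \<le> \<epsilon> * nrm Nc e0" if p: "p \<ge> Suc P" and Nc: "Nc \<ge> 1" for p Nc e0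
  proof -
    obtain q where q: "p = Suc q" "q \<ge> P" using p by (cases p) auto
    have "(\<phi>\<^sup>2) ^ q \<le> (\<phi>\<^sup>2) ^ P" using q phi2 by (intro power_decreasing) auto
    then have *: "(\<phi>\<^sup>2) ^ q * real k \<le> \<epsilon>\<^sup>2" using P k by (simp flip: pos_le_divide_eq)
    have "(nrm Nc (err Nc e0 p))\<^sup>2 \<le> \<phi> ^ (2 * q) * (nrm Nc (err Nc e0 1))\<^sup>2"
      unfolding q by (rule nrm_err_le[OF Nc])
    also have "\<dots> \<le> \<phi> ^ (2 * q) * (real k * \<phi>\<^sup>2 * (nrm Nc e0)\<^sup>2)"
      using nrm_err_1_le[OF Nc, of e0] phi_nonneg by (intro mult_left_mono) auto
    also have "\<dots> \<le> \<phi> ^ (2 * q) * (real k * 1 * (nrm Nc e0)\<^sup>2)"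
      using phi2 phi_nonneg by (intro mult_left_mono mult_right_mono) auto
    also have "\<dots> = ((\<phi>\<^sup>2) ^ q * real k) * (nrm Nc e0)\<^sup>2" by (simp add: power_mult)
    also have "\<dots> \<le> \<epsilon>\<^sup>2 * (nrm Nc e0)\<^sup>2" using * by (intro mult_right_mono) auto
    finally have "(nrm Nc (err Nc e0 p))\<^sup>2 \<le> (\<epsilon> * nrm Nc e0)\<^sup>2" by (simp add: power_mult_distrib)
    then show ?thesis by (rule power2_le_imp_le) (use \<epsilon> in simp)
  qed
  then show "\<exists>P. \<forall>p\<ge>P. \<forall>Nc\<ge>1. \<forall>e0. nrm Nc (err Nc e0 p) \<le> \<epsilon> * nrm Nc e0" by blast
qed

text \<open>For \<phi> \<ge> 1 and a fixed number of iterations, a large enough \<open>Nc\<close>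
  admits an error whose squared norm has at least half its initial value. Uniform convergence would
  bring it down to a quarter.\<close>

lemma phi_less_1_of_asymp_convergent:
  assumes "asymp_convergent k \<Phi> \<Psi> nrm" "best_fcf_teap k lam mu \<phi>"
  shows "\<phi> < 1"
proof (rule ccontr)
  assume "\<not> \<phi> < 1"
  then have phi: "\<phi> \<ge> 1" by simp
  obtain P where P: "\<And>p Nc e0. p \<ge> P \<Longrightarrow> Nc \<ge> 1 \<Longrightarrow> nrm Nc (err Nc e0 p) \<le> 1/2 * nrm Nc e0"
    using assms(1) unfolding asymp_convergent_def using half_gt_zero[OF zero_less_one] by blast
  obtain l where l: "cmod (c l) = \<phi> * (1 - cmod (mu l))"
    using best_fcf_teap_attained[OF assms(2)] by blast
  obtain C N0 where C: "C \<ge> 0" and N0: "N0 \<ge> 3" and ex: "\<And>Nc. Nc \<ge> N0 \<Longrightarrow> \<exists>e0. nrm Nc (err Nc e0 (Suc P)) > 0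
    \<and> (nrm Nc (err Nc e0 1))\<^sup>2 \<le> (1 / \<phi> ^ (2 * P) + C / (real Nc)\<^sup>2) * (nrm Nc (err Nc e0 (Suc P)))\<^sup>2
    \<and> (nrm Nc e0)\<^sup>2 \<le> (1 / \<phi> ^ (2 * Suc P) + C / (real Nc)\<^sup>2) * (nrm Nc (err Nc e0 (Suc P)))\<^sup>2"
    using near_extremal_error[OF _ l, of P] \<open>1 \<le> \<phi>\<close> by (meson less_le_trans zero_less_one)
  \<comment> \<open>\<open>Nc\<close> is taken large enough that the correction C / Nc^2 is at most
    1.\<close>
  obtain M :: nat where M: "C \<le> real M" using real_arch_simple by blast
  define Nc where "Nc = max N0 (max M 1)"
  have Nc: "Nc \<ge> N0" "Nc \<ge> 1" "real M \<le> real Nc" by (auto simp: Nc_def)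
  have "C \<le> real Nc * 1" using M Nc by simp
  also have "\<dots> \<le> (real Nc)\<^sup>2" using Nc(2) by (simp add: power2_eq_square)
  finally have CN: "C / (real Nc)\<^sup>2 \<le> 1" using Nc(2) by (simp add: divide_le_eq)
  obtain e0 where pos: "nrm Nc (err Nc e0 (Suc P)) > 0"
    and le: "(nrm Nc e0)\<^sup>2 \<le> (1 / \<phi> ^ (2 * Suc P) + C / (real Nc)\<^sup>2) * (nrm Nc (err Nc e0 (Suc P)))\<^sup>2"
    using ex[OF Nc(1)] by blast
  have "1 \<le> \<phi> ^ (2 * Suc P)" using phi by (rule one_le_power)
  then have "1 / \<phi> ^ (2 * Suc P) \<le> 1" by (simp add: divide_le_eq)
  with CN have "1 / \<phi> ^ (2 * Suc P) + C / (real Nc)\<^sup>2 \<le> 2" by linarith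
  then have "(nrm Nc e0)\<^sup>2 \<le> 2 * (nrm Nc (err Nc e0 (Suc P)))\<^sup>2"
    using le by (meson mult_right_mono order_trans zero_le_power2)
  also have "(nrm Nc (err Nc e0 (Suc P)))\<^sup>2 \<le> (1/2 * nrm Nc e0)\<^sup>2"
    using P[of "Suc P" Nc e0] Nc(2) by (intro power_mono) auto
  finally have "(nrm Nc e0)\<^sup>2 \<le> 0" by (simp add: power_mult_distrib power_divide)
  then have "nrm Nc e0 = 0" by simp
  then show False using P[of "Suc P" Nc e0] Nc(2) pos by simp
qed

text \<open>The function h is defined as the exact deficit for a chosen error, so the equality is
  automatic and the content is that the deficit is of order 1/Nc^2.\<close>

lemma convergence_tight:
  assumes "best_fcf_teap k lam mu \<phi>"
  shows "\<exists>h :: nat \<Rightarrow> real. h \<in> O(\<lambda>Nc. 1 / (real Nc)\<^sup>2)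
    \<and> (\<forall>Nc\<ge>1. \<exists>e0. nrm Nc e0 > 0
        \<and> (\<phi> > 0 \<and> Nc \<ge> 3 \<longrightarrow> nrm Nc (err Nc e0 1) > 0)
        \<and> (nrm Nc (err Nc e0 (Suc p)))\<^sup>2 = (\<phi> ^ (2 * p) - h Nc) * (nrm Nc (err Nc e0 1))\<^sup>2)"
proof -
  have e0: "\<exists>e0. nrm Nc e0 > 0" if "Nc \<ge> 1" for Nc
  proof -
    have "(\<Sum>m<Nc. (cmod 1)\<^sup>2) > 0" using that by simp
    then have "(nrm Nc (eigen_error k U undefined (\<lambda>_. 1)))\<^sup>2 > 0" unfolding nrm_eigen_error[OF that] .
    then show ?thesis using U_norm_nonneg by (metis less_eq_real_def zero_less_power2)
  qed
  have trivial: "(nrm Nc (err Nc e0 (Suc p)))\<^sup>2 = 0 \<and> (nrm Nc (err Nc e0 1))\<^sup>2 = 0"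
    if "nrm Nc (err Nc e0 1) = 0" "Nc \<ge> 1" for Nc e0
  proof -
    have "(nrm Nc (err Nc e0 (Suc p)))\<^sup>2 \<le> 0" using nrm_err_le[OF that(2), of e0 p] that(1) by simp
    then show ?thesis using that(1) by simp
  qed
  show ?thesis
  proof (cases "\<phi> > 0")
    case False
    \<comment> \<open>With constant zero a single iteration annihilates every error, and h = 0
      works.\<close>
    then have "\<phi> = 0" using phi_nonneg by simp
    then have z: "nrm Nc (err Nc e0 1) = 0" if "Nc \<ge> 1" for Nc e0
      using nrm_err_1_le[OF that, of e0] by simp
    show ?thesis
      using e0 False trivial z by (intro exI[of _ "\<lambda>_. 0"]) fastforce
  next
    case True
    obtain l where l: "cmod (c l) = \<phi> * (1 - cmod (mu l))"
      using best_fcf_teap_attained[OF assms] by blast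
    have c0: "c l \<noteq> 0" using l True mu(1)[of l] by auto
    obtain C N0 where C: "C \<ge> 0" and N0: "N0 \<ge> 3" and ex: "\<And>Nc. Nc \<ge> N0 \<Longrightarrow> \<exists>e0. nrm Nc (err Nc e0 (Suc p)) > 0
      \<and> (nrm Nc (err Nc e0 1))\<^sup>2 \<le> (1 / \<phi> ^ (2 * p) + C / (real Nc)\<^sup>2) * (nrm Nc (err Nc e0 (Suc p)))\<^sup>2
      \<and> (nrm Nc e0)\<^sup>2 \<le> (1 / \<phi> ^ (2 * Suc p) + C / (real Nc)\<^sup>2) * (nrm Nc (err Nc e0 (Suc p)))\<^sup>2"
      using near_extremal_error[OF True l, of p] by blast
    \<comment> \<open>With F = \<phi>^(2p) and t = C / Nc^2, inverting 1/F + t costs F^2 t, which is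
      K / Nc^2.\<close>
    define K where "K = \<phi> ^ (4 * p) * C"
    define good where "good Nc e0 \<longleftrightarrow> nrm Nc (err Nc e0 1) > 0 \<and> (Nc \<ge> N0 \<longrightarrow>
      (\<phi> ^ (2 * p) - K / (real Nc)\<^sup>2) * (nrm Nc (err Nc e0 1))\<^sup>2 \<le> (nrm Nc (err Nc e0 (Suc p)))\<^sup>2)" for Nc e0
    have "\<exists>e0. good Nc e0" if Nc: "Nc \<ge> 3" for Nc
    proof (cases "Nc \<ge> N0")
      case False
      then show ?thesis using exists_nrm_err_1_pos[OF c0 Nc] by (auto simp: good_def)
    next
      case big: True
      then obtain e0 where pos: "nrm Nc (err Nc e0 (Suc p)) > 0"
        and le: "(nrm Nc (err Nc e0 1))\<^sup>2 \<le> (1 / \<phi> ^ (2 * p) + C / (real Nc)\<^sup>2) * (nrm Nc (err Nc e0 (Suc p)))\<^sup>2"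
        using ex by blast
      define A B t F where "A = (nrm Nc (err Nc e0 1))\<^sup>2" and "B = (nrm Nc (err Nc e0 (Suc p)))\<^sup>2"
        and "t = C / (real Nc)\<^sup>2" and "F = \<phi> ^ (2 * p)"
      have nn: "A \<ge> 0" "B \<ge> 0" "t \<ge> 0" "F > 0" using C True by (auto simp: A_def B_def t_def F_def)
      have AB: "F * A \<le> B + F * t * B"
      proof -
        have "F * A \<le> F * ((1 / F + t) * B)"
          using le nn by (intro mult_left_mono) (auto simp: A_def B_def t_def F_def)
        then show ?thesis using nn by (simp add: algebra_simps)
      qed
      have BA: "B \<le> F * A" using nrm_err_le[of Nc e0 p] Nc by (simp add: A_def B_def F_def)
      \<comment> \<open>Inserting the upper bound for B into the small term alone leaves an estimate
        of the ratio B / A.\<close>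
      have "F * t * B \<le> F * t * (F * A)" using BA nn by (intro mult_left_mono) auto
      then have "(F - F * F * t) * A \<le> B" using AB by (simp add: algebra_simps)
      moreover have "F * F * t = K / (real Nc)\<^sup>2"
        by (simp add: F_def t_def K_def power_add[symmetric])
      moreover have "nrm Nc (err Nc e0 1) > 0"
      proof (rule ccontr)
        assume "\<not> ?thesis"
        then have "nrm Nc (err Nc e0 1) = 0" using U_norm_nonneg[of k U Nc "err Nc e0 1"] by linarith
        then show False using trivial[of Nc e0] pos Nc by simp
      qed
      ultimately show ?thesis by (auto simp: good_def A_def B_def F_def)
    qed
    then have "\<forall>Nc. \<exists>e0. Nc \<ge> 3 \<longrightarrow> good Nc e0" by blast
    from choice[OF this] obtain E where E: "\<And>Nc. Nc \<ge> 3 \<Longrightarrow> good Nc (E Nc)" by blast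
    define h where "h Nc = (if Nc < 3 then 0 else
      \<phi> ^ (2 * p) - (nrm Nc (err Nc (E Nc) (Suc p)))\<^sup>2 / (nrm Nc (err Nc (E Nc) 1))\<^sup>2)" for Nc
    have "h \<in> O(\<lambda>Nc. 1 / (real Nc)\<^sup>2)"
    proof (rule bigoI[of _ K], rule eventually_sequentiallyI[of N0])
      fix Nc assume Nc: "N0 \<le> Nc"
      then have Nc3: "Nc \<ge> 3" using N0 by simp
      define A B where "A = (nrm Nc (err Nc (E Nc) 1))\<^sup>2" and "B = (nrm Nc (err Nc (E Nc) (Suc p)))\<^sup>2"
      have A: "A > 0" using E[OF Nc3] by (simp add: good_def A_def)
      have lo: "(\<phi> ^ (2 * p) - K / (real Nc)\<^sup>2) * A \<le> B"
        using E[OF Nc3] Nc by (simp add: good_def A_def B_def)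
      have up: "B \<le> \<phi> ^ (2 * p) * A" using nrm_err_le[of Nc "E Nc" p] Nc3 by (simp add: A_def B_def)
      have "h Nc = \<phi> ^ (2 * p) - B / A" using Nc3 by (simp add: h_def A_def B_def)
      moreover have "\<phi> ^ (2 * p) - K / (real Nc)\<^sup>2 \<le> B / A" using lo A by (simp add: pos_le_divide_eq)
      moreover have "B / A \<le> \<phi> ^ (2 * p)" using up A by (simp add: pos_divide_le_eq)
      ultimately have "0 \<le> h Nc" "h Nc \<le> K / (real Nc)\<^sup>2" by linarith+
      then show "norm (h Nc) \<le> K * norm (1 / (real Nc)\<^sup>2)" by simp
    qed
    moreover have "\<exists>e0. nrm Nc e0 > 0 \<and> (\<phi> > 0 \<and> Nc \<ge> 3 \<longrightarrow> nrm Nc (err Nc e0 1) > 0)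
        \<and> (nrm Nc (err Nc e0 (Suc p)))\<^sup>2 = (\<phi> ^ (2 * p) - h Nc) * (nrm Nc (err Nc e0 1))\<^sup>2"
      if Nc: "Nc \<ge> 1" for Nc
    proof (cases "Nc \<ge> 3")
      case True
      have "nrm Nc (err Nc (E Nc) 1) > 0" using E[OF True] by (simp add: good_def)
      moreover from this have "nrm Nc (E Nc) > 0" by (rule nrm_pos_of_err_1_pos[OF Nc])
      ultimately show ?thesis using True by (intro exI[of _ "E Nc"]) (simp add: h_def)
    next
      case False
      obtain x where x: "nrm Nc x > 0" using e0[OF Nc] by blast
      \<comment> \<open>With fewer than three coarse points the delay pushes every image off the
        grid.\<close>
      have "coarse_op (c l') (mu l') y m = 0" if "m < Nc" for l' y m
        proof -
        have "m = 0 \<or> m = Suc 0" using that False by linarith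
        then show ?thesis by auto
      qed
      then have "nrm Nc (err Nc x 1) = 0"
        using nrm_err[OF Nc, of x 0] Nc by (simp add: ext_norm2_def)
      then show ?thesis using x False trivial[of Nc x] Nc by (intro exI[of _ x]) auto
    qed
    ultimately show ?thesis by blast
  qed
qed

lemma convergence_gap:
  "\<exists>g :: nat \<Rightarrow> real. (if p = 0 then g = (\<lambda>_. 0)
     else (\<forall>Nc\<ge>1. g Nc > 0) \<and> g \<in> \<Theta>(\<lambda>Nc. 1 / (real Nc)\<^sup>2))
   \<and> (\<forall>Nc\<ge>1. \<forall>e0. (nrm Nc (err Nc e0 (Suc p)))\<^sup>2
        \<le> (\<phi> ^ (2 * p) - g Nc) * (nrm Nc (err Nc e0 1))\<^sup>2)"
proof (cases "p = 0")
  case True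
  then show ?thesis by (intro exI[of _ "\<lambda>_. 0"]) simp
next
  case False
  have Theta: "(\<lambda>Nc. a / (real Nc)\<^sup>2) \<in> \<Theta>(\<lambda>Nc. 1 / (real Nc)\<^sup>2)" if "a > 0" for a :: real
  proof -
    have "(\<lambda>Nc. a * (1 / (real Nc)\<^sup>2)) \<in> \<Theta>(\<lambda>Nc. 1 / (real Nc)\<^sup>2)"
      using that by (subst landau_theta.cmult_in_iff) auto
    then show ?thesis by simp
  qed
  show ?thesis
  proof (cases "\<phi> = 0")
    case True
    \<comment> \<open>Here the general gap \<phi>^(2p) \<open>min_mu\<close> / Nc^2 would not be
      positive; as the first error vanishes, 1 / Nc^2 serves instead.\<close>
    then have z: "nrm Nc (err Nc e0 1) = 0" if "Nc \<ge> 1" for Nc e0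
      using nrm_err_1_le[OF that, of e0] by simp
    then have "(nrm Nc (err Nc e0 (Suc p)))\<^sup>2 \<le> 0" if "Nc \<ge> 1" for Nc e0
      using nrm_err_le[OF that, of e0 p] that by simp
    then show ?thesis
      using False z Theta[of 1] by (intro exI[of _ "\<lambda>Nc. 1 / (real Nc)\<^sup>2"]) auto
  next
    case nz: False
    then show ?thesis
      using False nrm_err_gap Theta[of "\<phi> ^ (2 * p) * min_mu"] min_mu(1) phi_nonneg
      by (intro exI[of _ "\<lambda>Nc. \<phi> ^ (2 * p) * min_mu / (real Nc)\<^sup>2"]) auto
  qed
qed

section \<open>Equivalence of the three norms, uniformly in the number of time points\<close>

lemma U_norm_bapply_bounds:
  "\<exists>b>0. \<forall>Nc x. nrm Nc x \<le> b * nrm Nc (bapply {..<num_points k Nc} (bidiag \<Phi>) x)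
    \<and> nrm Nc (bapply {..<num_points k Nc} (bidiag \<Phi>) x) \<le> 2 * nrm Nc x"
proof -
  define r where "r = Max (range (\<lambda>l. cmod (lam l)))"
  have "r \<in> range (\<lambda>l. cmod (lam l))" unfolding r_def by (intro Max_in) auto
  then obtain l where "r = cmod (lam l)" by blast
  then have r: "r < 1" using lam(1) by simp
  have rl: "cmod (lam l) \<le> r" for l unfolding r_def by (intro Max_ge) auto
  let ?A = "\<lambda>Nc. bapply {..<num_points k Nc} (bidiag \<Phi>)"
  have co: "coord U l (?A Nc x m) = coord U l (x m) - (if m > 0 then lam l * coord U l (x (m - 1)) else 0)"
    if "m < num_points k Nc" for l Nc x m
    using that by (simp add: bapply_bidiag coord_diff coord_eigen[OF diag(1)])
  have sq: "(nrm Nc (?A Nc x))\<^sup>2 = (\<Sum>l\<in>UNIV. \<Sum>m<num_points k Nc.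
      (cmod (coord U l (x m) - (if m > 0 then lam l * coord U l (x (m - 1)) else 0)))\<^sup>2)" for Nc x
    unfolding U_norm_sq by (intro sum.cong) (auto simp: co)
  have "(\<Sum>l\<in>UNIV. (1 - r)\<^sup>2 * (\<Sum>m<num_points k Nc. (cmod (coord U l (x m)))\<^sup>2))
    \<le> (nrm Nc (?A Nc x))\<^sup>2" for Nc x
    unfolding sq
  proof (rule sum_mono)
    fix l
    have "(1 - r)\<^sup>2 * (\<Sum>m<num_points k Nc. (cmod (coord U l (x m)))\<^sup>2)
      \<le> (1 - cmod (lam l))\<^sup>2 * (\<Sum>m<num_points k Nc. (cmod (coord U l (x m)))\<^sup>2)"
      using rl[of l] r by (intro mult_right_mono power_mono) (auto intro!: sum_nonneg)
    also have "\<dots> \<le> (\<Sum>m<num_points k Nc.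
      (cmod (coord U l (x m) - (if m > 0 then lam l * coord U l (x (m - 1)) else 0)))\<^sup>2)"
      by (rule bidiag_norm_bounds(1)[OF lam(1)])
    finally show "(1 - r)\<^sup>2 * (\<Sum>m<num_points k Nc. (cmod (coord U l (x m)))\<^sup>2)
      \<le> (\<Sum>m<num_points k Nc.
      (cmod (coord U l (x m) - (if m > 0 then lam l * coord U l (x (m - 1)) else 0)))\<^sup>2)" .
  qed
  then have "((1 - r) * nrm Nc x)\<^sup>2 \<le> (nrm Nc (?A Nc x))\<^sup>2" for Nc x
    unfolding power_mult_distrib U_norm_sq[of _ _ _ x] by (simp add: sum_distrib_left)
  then have lo: "(1 - r) * nrm Nc x \<le> nrm Nc (?A Nc x)" for Nc x
    by (rule power2_le_imp_le) simp
  have "(nrm Nc (?A Nc x))\<^sup>2 \<le> (\<Sum>l\<in>UNIV. 4 * (\<Sum>m<num_points k Nc. (cmod (coord U l (x m)))\<^sup>2))" for Nc x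
    unfolding sq by (intro sum_mono bidiag_norm_bounds(2) lam(1))
  also have "(\<Sum>l\<in>UNIV. 4 * (\<Sum>m<num_points k Nc. (cmod (coord U l (x m)))\<^sup>2)) = (2 * nrm Nc x)\<^sup>2" for Nc x
    unfolding power_mult_distrib U_norm_sq by (subst sum_distrib_left[symmetric]) simp
  finally have "(nrm Nc (?A Nc x))\<^sup>2 \<le> (2 * nrm Nc x)\<^sup>2" for Nc x .
  then have up: "nrm Nc (?A Nc x) \<le> 2 * nrm Nc x" for Nc x
    by (rule power2_le_imp_le) simp
  show ?thesis
    using lo up r by (intro exI[of _ "1 / (1 - r)"]) (auto simp: pos_le_divide_eq mult.commute)
qed

text \<open>The change of basis acts on each time point separately, so the operator norms of U and
  its inverse serve for every \<open>Nc\<close>.\<close>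

lemma l2_norm_U_norm_equiv:
  "\<exists>a\<ge>0. \<exists>b\<ge>0. \<forall>Nc x. nrm Nc x \<le> a * l2_norm k Nc x \<and> l2_norm k Nc x \<le> b * nrm Nc x"
proof -
  have pos: "onorm ((*v) (M :: complex ^ 'n ^ 'n)) \<ge> 0" for M
    by (rule onorm_pos_le[OF matrix_vector_mul_bounded_linear])
  have le: "norm (M *v y) \<le> onorm ((*v) M) * norm y" for M :: "complex ^ 'n ^ 'n" and y
    by (rule onorm[OF matrix_vector_mul_bounded_linear])
  have 1: "nrm Nc x \<le> onorm ((*v) (matrix_inv U)) * l2_norm k Nc x" for Nc x
    unfolding U_norm_def by (rule l2_norm_le[OF le pos])
  have "norm y \<le> onorm ((*v) U) * norm (matrix_inv U *v y)" for y
    using le[of U "matrix_inv U *v y"] matrix_inv_mult[OF invU]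
    by (simp add: matrix_vector_mul_assoc)
  then have 2: "l2_norm k Nc x \<le> onorm ((*v) U) * nrm Nc x" for Nc x
    unfolding U_norm_def by (rule l2_norm_le[OF _ pos])
  show ?thesis using pos 1 2 by blast
qed

lemma asymp_convergent_l2_norm_iff:
  "asymp_convergent k \<Phi> \<Psi> (l2_norm k) \<longleftrightarrow> asymp_convergent k \<Phi> \<Psi> nrm"
proof -
  obtain a b where ab: "a \<ge> 0" "b \<ge> 0" "\<And>Nc x. nrm Nc x \<le> a * l2_norm k Nc x"
    "\<And>Nc x. l2_norm k Nc x \<le> b * nrm Nc x"
    using l2_norm_U_norm_equiv by blast
  show ?thesis
  proof
    assume "asymp_convergent k \<Phi> \<Psi> (l2_norm k)"
    then show "asymp_convergent k \<Phi> \<Psi> nrm"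
      by (rule asymp_convergent_transfer[OF _ ab(2,1,4,3)]) simp
  next
    assume "asymp_convergent k \<Phi> \<Psi> nrm"
    then show "asymp_convergent k \<Phi> \<Psi> (l2_norm k)"
      by (rule asymp_convergent_transfer[OF _ ab]) simp
  qed
qed

lemma asymp_convergent_AA_norm_iff:
  "asymp_convergent k \<Phi> \<Psi> (AA_norm k \<Phi>) \<longleftrightarrow> asymp_convergent k \<Phi> \<Psi> nrm"
proof -
  obtain a b where ab: "a \<ge> 0" "b \<ge> 0" "\<And>Nc x. nrm Nc x \<le> a * l2_norm k Nc x"
    "\<And>Nc x. l2_norm k Nc x \<le> b * nrm Nc x"
    using l2_norm_U_norm_equiv by blast
  obtain d where d: "d > 0"
    "\<And>Nc x. nrm Nc x \<le> d * nrm Nc (bapply {..<num_points k Nc} (bidiag \<Phi>) x)"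
    "\<And>Nc x. nrm Nc (bapply {..<num_points k Nc} (bidiag \<Phi>) x) \<le> 2 * nrm Nc x"
    using U_norm_bapply_bounds by blast
  have 1: "nrm Nc x \<le> (d * a) * AA_norm k \<Phi> Nc x" for Nc x
  proof -
    have "d * nrm Nc (bapply {..<num_points k Nc} (bidiag \<Phi>) x) \<le> d * (a * AA_norm k \<Phi> Nc x)"
      unfolding AA_norm_def using ab d(1) by (intro mult_left_mono) auto
    with d(2)[of Nc x] show ?thesis by (simp add: mult.assoc)
  qed
  have 2: "AA_norm k \<Phi> Nc x \<le> (b * 2) * nrm Nc x" for Nc x
  proof -
    have "b * nrm Nc (bapply {..<num_points k Nc} (bidiag \<Phi>) x) \<le> b * (2 * nrm Nc x)"
      using ab d(3) by (intro mult_left_mono) auto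
    with ab(4)[of Nc "bapply {..<num_points k Nc} (bidiag \<Phi>) x"] show ?thesis
      by (simp add: AA_norm_def mult.assoc)
  qed
  have 3: "AA_norm k \<Phi> Nc x \<ge> 0" for Nc x by (simp add: AA_norm_def)
  have 4: "d * a \<ge> 0" "b * 2 \<ge> 0" using ab(1,2) d(1) by auto
  show ?thesis
  proof
    assume "asymp_convergent k \<Phi> \<Psi> (AA_norm k \<Phi>)"
    then show "asymp_convergent k \<Phi> \<Psi> nrm"
      by (rule asymp_convergent_transfer[OF _ 4(2,1) 2 1]) simp
  next
    assume "asymp_convergent k \<Phi> \<Psi> nrm"
    then show "asymp_convergent k \<Phi> \<Psi> (AA_norm k \<Phi>)"
      by (rule asymp_convergent_transfer[OF _ 4 1 2 3])
  qed
qed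

end

theorem theorem2p13:
  fixes \<Phi> \<Psi> U :: "complex ^ 'n ^ 'n"
    and lam mu :: "'n::finite \<Rightarrow> complex"
    and \<phi> :: real
    and k :: nat
  assumes "k \<ge> 2"
    and "invertible \<Phi>" and "invertible \<Psi>"
    and "\<exists>q. onorm ((*v) (mpow \<Phi> q)) < 1 \<and> onorm ((*v) (mpow \<Psi> q)) < 1"
    and "\<Phi> ** \<Psi> = \<Psi> ** \<Phi>"
    and "diagonalized_by \<Phi> U lam" and "diagonalized_by \<Psi> U mu"
    and "fcf_teap k lam mu \<phi>"
  shows
    "(\<phi> < 1 \<longrightarrow>
       (\<forall>Nc\<ge>1. \<forall>e0. (U_norm k U Nc (mgrit_error k \<Phi> \<Psi> Nc e0 1))\<^sup>2
                      \<le> real k * (U_norm k U Nc e0)\<^sup>2)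
       \<and> (\<forall>p. \<exists>g :: nat \<Rightarrow> real.
            (if p = 0 then g = (\<lambda>_. 0)
             else (\<forall>Nc\<ge>1. g Nc > 0) \<and> g \<in> \<Theta>(\<lambda>Nc. 1 / (real Nc)\<^sup>2))
            \<and> (\<forall>Nc\<ge>1. \<forall>e0. (U_norm k U Nc (mgrit_error k \<Phi> \<Psi> Nc e0 (p + 1)))\<^sup>2
                 \<le> (\<phi> ^ (2 * p) - g Nc) * (U_norm k U Nc (mgrit_error k \<Phi> \<Psi> Nc e0 1))\<^sup>2))
       \<and> (best_fcf_teap k lam mu \<phi> \<longrightarrow>
            (\<forall>p. \<exists>h :: nat \<Rightarrow> real. h \<in> O(\<lambda>Nc. 1 / (real Nc)\<^sup>2)
              \<and> (\<forall>Nc\<ge>1. \<exists>e0. U_norm k U Nc e0 > 0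
                  \<and> (\<phi> > 0 \<and> Nc \<ge> 3 \<longrightarrow> U_norm k U Nc (mgrit_error k \<Phi> \<Psi> Nc e0 1) > 0)
                  \<and> (U_norm k U Nc (mgrit_error k \<Phi> \<Psi> Nc e0 (p + 1)))\<^sup>2
                      = (\<phi> ^ (2 * p) - h Nc)
                          * (U_norm k U Nc (mgrit_error k \<Phi> \<Psi> Nc e0 1))\<^sup>2)))
       \<and> asymp_convergent k \<Phi> \<Psi> (l2_norm k)
       \<and> asymp_convergent k \<Phi> \<Psi> (AA_norm k \<Phi>))
     \<and> (best_fcf_teap k lam mu \<phi> \<longrightarrow>
          (asymp_convergent k \<Phi> \<Psi> (l2_norm k) \<longleftrightarrow> \<phi> < 1)
          \<and> (asymp_convergent k \<Phi> \<Psi> (AA_norm k \<Phi>) \<longleftrightarrow> \<phi> < 1))"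
proof -
  obtain q where q: "onorm ((*v) (mpow \<Phi> q)) < 1" "onorm ((*v) (mpow \<Psi> q)) < 1"
    using assms(4) by blast
  \<comment> \<open>The bounds on powers place both spectra in the open unit disc, and invertibility
    keeps them away from zero.\<close>
  interpret diagonalized_mgrit \<Phi> \<Psi> U lam mu \<phi> k
    using assms eigenvalue_norm_less_1[OF assms(6) q(1)] eigenvalue_norm_less_1[OF assms(7) q(2)]
      eigenvalue_neq_0[OF assms(6,2)] eigenvalue_neq_0[OF assms(7,3)]
    by unfold_locales auto
  have first: "(nrm Nc (err Nc e0 1))\<^sup>2 \<le> real k * (nrm Nc e0)\<^sup>2" if "\<phi> < 1" "Nc \<ge> 1" for Nc e0
  proof -
    have "\<phi>\<^sup>2 \<le> 1" using that(1) phi_nonneg by (simp add: power_le_one)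
    then have "real k * \<phi>\<^sup>2 * (nrm Nc e0)\<^sup>2 \<le> real k * 1 * (nrm Nc e0)\<^sup>2"
      by (intro mult_right_mono mult_left_mono) auto
    with nrm_err_1_le[OF that(2), of e0] show ?thesis by simp
  qed
  have conv: "asymp_convergent k \<Phi> \<Psi> (l2_norm k)" "asymp_convergent k \<Phi> \<Psi> (AA_norm k \<Phi>)" if "\<phi> < 1"
    using asymp_convergent_U_norm[OF that] asymp_convergent_l2_norm_iff asymp_convergent_AA_norm_iff
    by blast+
  have iff: "(asymp_convergent k \<Phi> \<Psi> (l2_norm k) \<longleftrightarrow> \<phi> < 1)
      \<and> (asymp_convergent k \<Phi> \<Psi> (AA_norm k \<Phi>) \<longleftrightarrow> \<phi> < 1)" if "best_fcf_teap k lam mu \<phi>"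
    using asymp_convergent_U_norm phi_less_1_of_asymp_convergent[OF _ that]
      asymp_convergent_l2_norm_iff asymp_convergent_AA_norm_iff by blast
  show ?thesis
    unfolding Suc_eq_plus1[symmetric] using first conv iff convergence_gap convergence_tight by (intro conjI impI) blast+
qed

end
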